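(* Let the loan-to-value process be $$\mathrm{LTV}_t=\frac{hV_0}{2C}\,Z_t,\qquad Z_t=p_A(t)+p_B(t),\qquad p_i(t)=S^i_t/S^i_0,$$ where $dS^i_t/S^i_t=\sigma_i\,dW^i_t$ for $i\in\{A,B\}$ and $dW^A_t\,dW^B_t=\rho\,dt$ with $\rho\in(-1,1)$, and $V_0,C>0$, $h\in(0,1]$; thus $\mathrm{LTV}_0=hV_0/C$. Let $\ell_{\max}\ge\mathrm{LTV}_0$ be the liquidation threshold and let $$\tau=\inf\{t\ge0:\mathrm{LTV}_t\ge\ell_{\max}\}.$$ Under the moment-matched geometric Brownian motion approximation of $Z_t$ (described in the context) with drift $\tilde\mu=0$ and volatility $\tilde\sigma$, define the log-process drift $\nu:=\tilde\mu-\tilde\sigma^2/2=-\tilde\sigma^2/2$. Then the probability of liquidation during $[0,T]$ is $$\Pr(\tau\le T)\approx\Phi\!\left(\frac{-b-\frac{\tilde\sigma^2}{2}T}{\tilde\sigma\sqrt T}\right)+\frac{\mathrm{LTV}_0}{\ell_{\max}}\,\Phi\!\left(\frac{-b+\frac{\tilde\sigma^2}{2}T}{\tilde\sigma\sqrt T}\right),$$ where $b=\ln(\ell_{\max}C/(hV_0))=\ln(\ell_{\max}/\mathrm{LTV}_0)$ is the log-distance to the liquidation barrier, $\Phi$ is the standard normal cumulative distribution function, and the coefficient $e^{2\nu b/\tilde\sigma^2}=e^{-b}=\mathrm{LTV}_0/\ell_{\max}$ follows from substituting $\nu=-\tilde\sigma^2/2$.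
   Context: $\mathrm{LTV}_t$ is the loan-to-value ratio of a borrower who hedges a fraction $h$ of a liquidity position of initial value $V_0$ by borrowing tokens $A$ and $B$ against stablecoin collateral $C$; the position is liquidated when the ratio reaches $\ell_{\max}$. Moment-matched approximation: $Z_t$, a sum of two correlated geometric Brownian motions, is approximated by a single geometric Brownian motion $\hat Z_t=2\exp\bigl((\tilde\mu-\tilde\sigma^2/2)t+\tilde\sigma\tilde W_t\bigr)$, with $\tilde W$ a standard Brownian motion, having the same first two moments, $\mathbb{E}[Z_t]=2$ and $\mathbb{E}[Z_t^2]=e^{\sigma_A^2t}+e^{\sigma_B^2t}+2e^{\rho\sigma_A\sigma_Bt}$. This gives $\tilde\mu=0$ and $$\tilde\sigma^2=\frac1t\ln\!\left(\frac{e^{\sigma_A^2t}+e^{\sigma_B^2t}+2e^{\rho\sigma_A\sigma_Bt}}{4}\right).$$ So $\mathrm{LTV}_t/\mathrm{LTV}_0\approx\hat Z_t/2$, and the liquidation boundary in log-space is $b$. The quantity $\tilde\sigma$ depends on the horizon $t$, but only weakly, and is treated as approximately constant. *)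

theory Defs
  imports "HOL-Probability.Probability"
begin

section \<open>Brownian motion\<close>

definition brownian_motion :: "'a measure \<Rightarrow> (real \<Rightarrow> 'a \<Rightarrow> real) \<Rightarrow> bool" where
  "brownian_motion M W \<longleftrightarrow>
     (\<forall>t\<ge>0. W t \<in> borel_measurable M) \<and>
     (AE \<omega> in M. W 0 \<omega> = 0) \<and>
     (\<forall>\<omega>\<in>space M. continuous_on {0..} (\<lambda>t. W t \<omega>)) \<and>
     (\<forall>s t. 0 \<le> s \<and> s < t \<longrightarrow>
        distributed M lborel (\<lambda>\<omega>. W t \<omega> - W s \<omega>) (normal_density 0 (sqrt (t - s)))) \<and>
     (\<forall>(n::nat) (t::nat \<Rightarrow> real). 0 \<le> t 0 \<and> (\<forall>i<n. t i \<le> t (Suc i)) \<longrightarrow>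
        prob_space.indep_vars M (\<lambda>_. borel) (\<lambda>i \<omega>. W (t (Suc i)) \<omega> - W (t i) \<omega>) {..<n})"

definition adapted_process :: "(real \<Rightarrow> 'a measure) \<Rightarrow> (real \<Rightarrow> 'a \<Rightarrow> real) \<Rightarrow> bool" where
  "adapted_process F X \<longleftrightarrow> (\<forall>t\<ge>0. X t \<in> borel_measurable (F t))"

definition brownian_motion_wrt ::
    "'a measure \<Rightarrow> (real \<Rightarrow> 'a measure) \<Rightarrow> (real \<Rightarrow> 'a \<Rightarrow> real) \<Rightarrow> bool" where
  "brownian_motion_wrt M F W \<longleftrightarrow>
     brownian_motion M W \<and> adapted_process F W \<and>
     (\<forall>s t. 0 \<le> s \<and> s \<le> t \<longrightarrow>
        prob_space.indep_set M (sets (F s))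
          {(\<lambda>\<omega>. W t \<omega> - W s \<omega>) -` A \<inter> space M | A. A \<in> sets borel})"

definition martingale ::
    "'a measure \<Rightarrow> (real \<Rightarrow> 'a measure) \<Rightarrow> (real \<Rightarrow> 'a \<Rightarrow> real) \<Rightarrow> bool" where
  "martingale M F X \<longleftrightarrow>
     adapted_process F X \<and> (\<forall>t\<ge>0. integrable M (X t)) \<and>
     (\<forall>s t. 0 \<le> s \<and> s \<le> t \<longrightarrow> (AE \<omega> in M. real_cond_exp M (F s) (X t) \<omega> = X s \<omega>))"

text \<open>
  The relation \<open>dV dW = \<rho> dt\<close> says that the bracket of \<open>V\<close> and \<open>W\<close> at time \<open>t\<close> is
  \<open>\<rho> t\<close>, that is, that \<open>V W - \<rho> t\<close> is a martingale.
\<close>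

definition correlated_brownian_motions ::
    "'a measure \<Rightarrow> (real \<Rightarrow> 'a measure) \<Rightarrow> real \<Rightarrow> (real \<Rightarrow> 'a \<Rightarrow> real) \<Rightarrow> (real \<Rightarrow> 'a \<Rightarrow> real) \<Rightarrow> bool"
  where
  "correlated_brownian_motions M F \<rho> V W \<longleftrightarrow>
     brownian_motion_wrt M F V \<and> brownian_motion_wrt M F W \<and>
     martingale M F (\<lambda>t \<omega>. V t \<omega> * W t \<omega> - \<rho> * t)"


section \<open>The Ito integral and the driftless price equation\<close>

text \<open>
  A simple integrand on \<open>{0..T}\<close> is the process equal to \<open>\<xi> i\<close> on \<open>{t i<..t (Suc i)}\<close> for
  \<open>i < n\<close>, and to 0 elsewhere.
\<close>

definition simple_integrand ::
    "'a measure \<Rightarrow> (real \<Rightarrow> 'a measure) \<Rightarrow> real \<Rightarrow> nat \<Rightarrow> (nat \<Rightarrow> real) \<Rightarrow> (nat \<Rightarrow> 'a \<Rightarrow> real) \<Rightarrow> bool"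
  where
  "simple_integrand M F T n t \<xi> \<longleftrightarrow>
     0 \<le> t 0 \<and> t n \<le> T \<and> (\<forall>i<n. t i \<le> t (Suc i)) \<and>
     (\<forall>i<n. \<xi> i \<in> borel_measurable (F (t i)) \<and> (\<exists>K. \<forall>\<omega>\<in>space M. \<bar>\<xi> i \<omega>\<bar> \<le> K))"

definition simple_value ::
    "nat \<Rightarrow> (nat \<Rightarrow> real) \<Rightarrow> (nat \<Rightarrow> 'a \<Rightarrow> real) \<Rightarrow> real \<Rightarrow> 'a \<Rightarrow> real" where
  "simple_value n t \<xi> s \<omega> = (\<Sum>i<n. \<xi> i \<omega> * indicator {t i<..t (Suc i)} s)"

definition simple_integral_wrt ::
    "(real \<Rightarrow> 'a \<Rightarrow> real) \<Rightarrow> nat \<Rightarrow> (nat \<Rightarrow> real) \<Rightarrow> (nat \<Rightarrow> 'a \<Rightarrow> real) \<Rightarrow> 'a \<Rightarrow> real" where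
  "simple_integral_wrt W n t \<xi> \<omega> = (\<Sum>i<n. \<xi> i \<omega> * (W (t (Suc i)) \<omega> - W (t i) \<omega>))"

text \<open>
  \<open>I\<close> is a version of the Ito integral of \<open>H\<close> against \<open>W\<close> over \<open>{0..T}\<close>: the
  mean-square limit of the integrals of simple integrands that converge to \<open>H\<close> in mean square
  for the product of \<open>M\<close> and Lebesgue measure on \<open>{0..T}\<close>.
\<close>

definition has_ito_integral ::
    "'a measure \<Rightarrow> (real \<Rightarrow> 'a measure) \<Rightarrow> (real \<Rightarrow> 'a \<Rightarrow> real) \<Rightarrow> (real \<Rightarrow> 'a \<Rightarrow> real) \<Rightarrow> real
      \<Rightarrow> ('a \<Rightarrow> real) \<Rightarrow> bool"
  where
  "has_ito_integral M F W H T I \<longleftrightarrow>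
     I \<in> borel_measurable M \<and>
     (\<exists>(n :: nat \<Rightarrow> nat) (t :: nat \<Rightarrow> nat \<Rightarrow> real) (\<xi> :: nat \<Rightarrow> nat \<Rightarrow> 'a \<Rightarrow> real).
        (\<forall>k. simple_integrand M F T (n k) (t k) (\<xi> k)) \<and>
        (\<lambda>k. \<integral>\<^sup>+\<omega>. (\<integral>\<^sup>+s\<in>{0..T}. ennreal ((H s \<omega> - simple_value (n k) (t k) (\<xi> k) s \<omega>)\<^sup>2) \<partial>lborel) \<partial>M)
          \<longlonglongrightarrow> 0 \<and>
        (\<lambda>k. \<integral>\<^sup>+\<omega>. ennreal ((I \<omega> - simple_integral_wrt W (n k) (t k) (\<xi> k) \<omega>)\<^sup>2) \<partial>M)
          \<longlonglongrightarrow> 0)"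

text \<open>
  The equation \<open>dS / S = \<sigma> dW\<close>, in integrated form, with a deterministic positive initial price.
\<close>

definition driftless_price_process ::
    "'a measure \<Rightarrow> (real \<Rightarrow> 'a measure) \<Rightarrow> (real \<Rightarrow> 'a \<Rightarrow> real) \<Rightarrow> real \<Rightarrow> (real \<Rightarrow> 'a \<Rightarrow> real) \<Rightarrow> bool"
  where
  "driftless_price_process M F W \<sigma> S \<longleftrightarrow>
     adapted_process F S \<and>
     (\<forall>\<omega>\<in>space M. continuous_on {0..} (\<lambda>t. S t \<omega>)) \<and>
     (\<exists>c>0. \<forall>\<omega>\<in>space M. S 0 \<omega> = c) \<and>
     (\<forall>t\<ge>0. \<exists>I. has_ito_integral M F W (\<lambda>s \<omega>. \<sigma> * S s \<omega>) t I \<and>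
        (AE \<omega> in M. S t \<omega> = S 0 \<omega> + I \<omega>))"


section \<open>The loan-to-value model and its approximation\<close>

definition relative_price_sum ::
    "(real \<Rightarrow> 'a \<Rightarrow> real) \<Rightarrow> (real \<Rightarrow> 'a \<Rightarrow> real) \<Rightarrow> real \<Rightarrow> 'a \<Rightarrow> real" where
  "relative_price_sum SA SB t \<omega> = SA t \<omega> / SA 0 \<omega> + SB t \<omega> / SB 0 \<omega>"

definition loan_to_value ::
    "real \<Rightarrow> real \<Rightarrow> real \<Rightarrow> (real \<Rightarrow> 'a \<Rightarrow> real) \<Rightarrow> real \<Rightarrow> 'a \<Rightarrow> real" where
  "loan_to_value h V0 C Z t \<omega> = h * V0 / (2 * C) * Z t \<omega>"

text \<open>The infimum is taken in \<open>ereal\<close>, so it is \<open>\<infinity>\<close> on paths that never reach the level.\<close>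

definition liquidation_time :: "real \<Rightarrow> (real \<Rightarrow> 'a \<Rightarrow> real) \<Rightarrow> 'a \<Rightarrow> ereal" where
  "liquidation_time l X \<omega> = Inf {ereal t | t. 0 \<le> t \<and> l \<le> X t \<omega>}"

definition geometric_bm ::
    "real \<Rightarrow> real \<Rightarrow> real \<Rightarrow> (real \<Rightarrow> 'a \<Rightarrow> real) \<Rightarrow> real \<Rightarrow> 'a \<Rightarrow> real" where
  "geometric_bm z \<mu> \<sigma> W t \<omega> = z * exp ((\<mu> - \<sigma>\<^sup>2 / 2) * t + \<sigma> * W t \<omega>)"

definition same_two_moments ::
    "'a measure \<Rightarrow> ('a \<Rightarrow> real) \<Rightarrow> 'b measure \<Rightarrow> ('b \<Rightarrow> real) \<Rightarrow> bool" where
  "same_two_moments M X N Y \<longleftrightarrow>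
     (\<integral>\<omega>. X \<omega> \<partial>M) = (\<integral>\<omega>. Y \<omega> \<partial>N) \<and> (\<integral>\<omega>. (X \<omega>)\<^sup>2 \<partial>M) = (\<integral>\<omega>. (Y \<omega>)\<^sup>2 \<partial>N)"

abbreviation std_normal_cdf :: "real \<Rightarrow> real"  (\<open>\<Phi>\<close>) where
  "\<Phi> \<equiv> cdf std_normal_distribution"

end

theory Submission
  imports Defs
begin

text \<open>
  Moments: by the polarised Ito isometry, \<open>m t = E [S\<^sub>A t S\<^sub>B t]\<close> solves
  \<open>m t = m 0 + \<rho> \<sigma>\<^sub>A \<sigma>\<^sub>B \<integral> m\<close>, so it is an exponential; \<open>V = W\<close> and \<open>\<rho> = 1\<close> give the second
  moments. No Ito formula is needed.

  Crossing probability: let \<open>X\<close> be the log-price, with drift \<open>- \<sigma>\<^sup>2 / 2\<close>, and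
  \<open>\<psi> z = 1 + exp z\<close> for \<open>z \<ge> 0\<close>, \<open>\<psi> z = 0\<close> otherwise. The symmetry of the normal law gives
  \<open>E [\<psi> (X\<^sub>T - X\<^sub>t)] = 1\<close> for all \<open>t < T\<close>. On a finite grid, stopping at the first grid time with
  \<open>X\<^sub>t \<ge> b\<close> and using the monotonicity of \<open>\<psi>\<close> therefore shows that the grid crosses \<open>b\<close> with
  probability at most \<open>E [\<psi> (X\<^sub>T - b)]\<close>, and with probability at least \<open>E [\<psi> (X\<^sub>T - b - \<delta>)]\<close> up to
  the event that some increment exceeds \<open>\<delta>\<close>. Refining the grid and letting \<open>\<delta> \<rightarrow> 0\<close> gives equality
  by path continuity, which replaces the strong Markov property.
\<close>

section \<open>Mean-square limits\<close>

text \<open>The form of \<psi> comes from a change of measure. With drift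
  \<open>- \<sigma>\<^sup>2 / 2\<close>, weighting an increment D of the log-price by exp D turns
  the drift into \<open>\<sigma>\<^sup>2 / 2\<close>, so the weighted law of D is the law of -D.
  Hence E [exp D; D >= 0] = P (D <= 0), and adding P (D >= 0) gives 1. The same tilt at level b
  yields the two \<Phi> terms, the second with coefficient exp (-b). The stopping argument uses only
  independence of finitely many increments, which is what \<open>brownian_motion\<close> offers: the
  approximating space carries no filtration.

  On the price side the obstacle is that \<open>has_ito_integral\<close> gives only mean-square
  approximation by simple integrands, with unrelated partitions for the two prices. Covariances are
  therefore computed for arbitrary pairs of increments. They contain the length of the overlap of
  two intervals, and the same lengths arise when the integrands are multiplied and integrated over
  the product space. Path continuity supplies the joint measurability for Fubini. The matched
  moments also force \<sigma> > 0, which the division by \<open>\<sigma> * sqrt T\<close>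
  requires.\<close>

lemma integrable_mult_square_integrable:
  fixes f g :: "'a \<Rightarrow> real"
  assumes [measurable]: "f \<in> borel_measurable M" "g \<in> borel_measurable M"
    and "integrable M (\<lambda>x. (f x)\<^sup>2)" "integrable M (\<lambda>x. (g x)\<^sup>2)"
  shows "integrable M (\<lambda>x. f x * g x)"
proof (rule Bochner_Integration.integrable_bound)
  show "integrable M (\<lambda>x. (f x)\<^sup>2 + (g x)\<^sup>2)"
    using assms by simp
  have "\<bar>a * b\<bar> \<le> a\<^sup>2 + b\<^sup>2" for a b :: real
  proof -
    have "2 * (\<bar>a\<bar> * \<bar>b\<bar>) \<le> \<bar>a\<bar>\<^sup>2 + \<bar>b\<bar>\<^sup>2"
      using sum_squares_bound[of "\<bar>a\<bar>" "\<bar>b\<bar>"] by (simp add: algebra_simps)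
    moreover have "0 \<le> \<bar>a\<bar> * \<bar>b\<bar>"
      by simp
    ultimately show ?thesis
      unfolding abs_mult power2_abs by linarith
  qed
  then show "AE x in M. norm (f x * g x) \<le> norm ((f x)\<^sup>2 + (g x)\<^sup>2)"
    by (simp add: order_trans[OF _ abs_ge_self])
qed measurable

lemma integrable_square_add:
  fixes f g :: "'a \<Rightarrow> real"
  assumes "f \<in> borel_measurable M" "g \<in> borel_measurable M"
    and "integrable M (\<lambda>x. (f x)\<^sup>2)" "integrable M (\<lambda>x. (g x)\<^sup>2)"
  shows "integrable M (\<lambda>x. (f x + g x)\<^sup>2)"
  unfolding power2_sum using assms
  by (intro Bochner_Integration.integrable_add)
    (simp_all add: mult.assoc integrable_mult_square_integrable)

lemma integrable_square_diff:
  fixes f g :: "'a \<Rightarrow> real"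
  assumes "f \<in> borel_measurable M" "g \<in> borel_measurable M"
    and "integrable M (\<lambda>x. (f x)\<^sup>2)" "integrable M (\<lambda>x. (g x)\<^sup>2)"
  shows "integrable M (\<lambda>x. (f x - g x)\<^sup>2)"
  using integrable_square_add[of f M "\<lambda>x. - g x"] assms by simp

text \<open>The inequality for nonnegative integrals, applied to absolute values; square
  integrability makes every integral finite, so the \<open>ennreal\<close> statement can be read
  back in the reals.\<close>

lemma Cauchy_Schwarz_integral:
  fixes f g :: "'a \<Rightarrow> real"
  assumes [measurable]: "f \<in> borel_measurable M" "g \<in> borel_measurable M"
    and f: "integrable M (\<lambda>x. (f x)\<^sup>2)" and g: "integrable M (\<lambda>x. (g x)\<^sup>2)"
  shows "\<bar>\<integral>x. f x * g x \<partial>M\<bar> \<le> sqrt (\<integral>x. (f x)\<^sup>2 \<partial>M) * sqrt (\<integral>x. (g x)\<^sup>2 \<partial>M)"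
proof -
  let ?I = "\<integral>x. \<bar>f x\<bar> * \<bar>g x\<bar> \<partial>M"
  have int: "integrable M (\<lambda>x. \<bar>f x\<bar> * \<bar>g x\<bar>)"
    using integrable_abs[OF integrable_mult_square_integrable[OF assms]] by (simp add: abs_mult)
  have "(\<integral>\<^sup>+x. ennreal \<bar>f x\<bar> * ennreal \<bar>g x\<bar> \<partial>M)\<^sup>2
      \<le> (\<integral>\<^sup>+x. ennreal \<bar>f x\<bar> ^ 2 \<partial>M) * (\<integral>\<^sup>+x. ennreal \<bar>g x\<bar> ^ 2 \<partial>M)"
    by (rule Cauchy_Schwarz_nn_integral) measurable
  then have "(ennreal ?I)\<^sup>2 \<le> ennreal (\<integral>x. (f x)\<^sup>2 \<partial>M) * ennreal (\<integral>x. (g x)\<^sup>2 \<partial>M)"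
    using int f g
    by (simp add: ennreal_mult[symmetric] ennreal_power nn_integral_eq_integral)
  then have "?I\<^sup>2 \<le> (\<integral>x. (f x)\<^sup>2 \<partial>M) * (\<integral>x. (g x)\<^sup>2 \<partial>M)"
    by (simp add: ennreal_mult[symmetric] ennreal_power)
  then have "?I \<le> sqrt ((\<integral>x. (f x)\<^sup>2 \<partial>M) * (\<integral>x. (g x)\<^sup>2 \<partial>M))"
    by (rule real_le_rsqrt)
  moreover have "\<bar>\<integral>x. f x * g x \<partial>M\<bar> \<le> ?I"
    using integral_abs_bound[of M "\<lambda>x. f x * g x"] by (simp add: abs_mult)
  ultimately show ?thesis
    by (simp add: real_sqrt_mult)
qed

text \<open>Convergence is phrased with nonnegative integrals as in \<open>has_ito_integral\<close>,
  with no integrability of \<open>f\<close> given in advance. One approximant at finite distance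
  already forces it, since \<open>f = (f - fs k) + fs k\<close>.\<close>

lemma mean_square_limit:
  fixes f :: "'a \<Rightarrow> real" and fs :: "nat \<Rightarrow> 'a \<Rightarrow> real"
  assumes [measurable]: "f \<in> borel_measurable M" "\<And>k. fs k \<in> borel_measurable M"
    and fs: "\<And>k. integrable M (\<lambda>x. (fs k x)\<^sup>2)"
    and lim: "(\<lambda>k. \<integral>\<^sup>+x. ennreal ((f x - fs k x)\<^sup>2) \<partial>M) \<longlonglongrightarrow> 0"
  shows "integrable M (\<lambda>x. (f x)\<^sup>2)" and "(\<lambda>k. \<integral>x. (f x - fs k x)\<^sup>2 \<partial>M) \<longlonglongrightarrow> 0"
proof -
  have "\<forall>\<^sub>F k in sequentially. (\<integral>\<^sup>+x. ennreal ((f x - fs k x)\<^sup>2) \<partial>M) < 1"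
    using lim by (rule order_tendstoD) simp
  then obtain k where "(\<integral>\<^sup>+x. ennreal ((f x - fs k x)\<^sup>2) \<partial>M) < 1"
    using eventually_happens by force
  then have "(\<integral>\<^sup>+x. ennreal ((f x - fs k x)\<^sup>2) \<partial>M) < \<infinity>"
    by (rule order_less_trans) simp
  then have "integrable M (\<lambda>x. (f x - fs k x)\<^sup>2)"
    by (intro integrableI_bounded) simp_all
  then have "integrable M (\<lambda>x. ((f x - fs k x) + fs k x)\<^sup>2)"
    by (intro integrable_square_add fs) measurable
  then show f: "integrable M (\<lambda>x. (f x)\<^sup>2)"
    by simp
  have "(\<integral>\<^sup>+x. ennreal ((f x - fs k x)\<^sup>2) \<partial>M) = ennreal (\<integral>x. (f x - fs k x)\<^sup>2 \<partial>M)" for k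
    using f fs by (intro nn_integral_eq_integral integrable_square_diff) simp_all
  then have "(\<lambda>k. ennreal (\<integral>x. (f x - fs k x)\<^sup>2 \<partial>M)) \<longlonglongrightarrow> ennreal 0"
    using lim by simp
  then show "(\<lambda>k. \<integral>x. (f x - fs k x)\<^sup>2 \<partial>M) \<longlonglongrightarrow> 0"
    by (subst (asm) tendsto_ennreal_iff) simp_all
qed

text \<open>Continuity of the inner product in mean square, over any measure because it is used
  twice: on \<open>M\<close> for the stochastic integrals and on the product with Lebesgue measure
  for the integrands.\<close>

lemma tendsto_mean_square_inner:
  fixes f g :: "'a \<Rightarrow> real" and fs gs :: "nat \<Rightarrow> 'a \<Rightarrow> real"
  assumes [measurable]: "f \<in> borel_measurable M" "\<And>k. fs k \<in> borel_measurable M"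
      "g \<in> borel_measurable M" "\<And>k. gs k \<in> borel_measurable M"
    and fs: "\<And>k. integrable M (\<lambda>x. (fs k x)\<^sup>2)" and gs: "\<And>k. integrable M (\<lambda>x. (gs k x)\<^sup>2)"
    and f_lim: "(\<lambda>k. \<integral>\<^sup>+x. ennreal ((f x - fs k x)\<^sup>2) \<partial>M) \<longlonglongrightarrow> 0"
    and g_lim: "(\<lambda>k. \<integral>\<^sup>+x. ennreal ((g x - gs k x)\<^sup>2) \<partial>M) \<longlonglongrightarrow> 0"
  shows "(\<lambda>k. \<integral>x. fs k x * gs k x \<partial>M) \<longlonglongrightarrow> (\<integral>x. f x * g x \<partial>M)"
proof -
  note f = mean_square_limit[OF assms(1,2) fs f_lim]
  note g = mean_square_limit[OF assms(3,4) gs g_lim]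
  define a where "a k x = f x - fs k x" for k x
  define c where "c k x = g x - gs k x" for k x
  have [measurable]: "a k \<in> borel_measurable M" "c k \<in> borel_measurable M" for k
    unfolding a_def c_def by measurable
  have a: "integrable M (\<lambda>x. (a k x)\<^sup>2)" and c: "integrable M (\<lambda>x. (c k x)\<^sup>2)" for k
    unfolding a_def c_def using f g fs gs by (auto intro!: integrable_square_diff)
  \<comment> \<open>Cauchy-Schwarz bounds for the three error terms \<open>- f * c\<close>,
    \<open>- a * g\<close> and \<open>a * c\<close> in the expansion of
    \<open>(f - a) * (g - c)\<close>.\<close>
  define R where "R k = sqrt (\<integral>x. (f x)\<^sup>2 \<partial>M) * sqrt (\<integral>x. (c k x)\<^sup>2 \<partial>M)
    + sqrt (\<integral>x. (a k x)\<^sup>2 \<partial>M) * sqrt (\<integral>x. (g x)\<^sup>2 \<partial>M)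
    + sqrt (\<integral>x. (a k x)\<^sup>2 \<partial>M) * sqrt (\<integral>x. (c k x)\<^sup>2 \<partial>M)" for k
  have "R \<longlonglongrightarrow> sqrt (\<integral>x. (f x)\<^sup>2 \<partial>M) * sqrt 0 + sqrt 0 * sqrt (\<integral>x. (g x)\<^sup>2 \<partial>M) + sqrt 0 * sqrt 0"
    unfolding R_def a_def c_def by (intro tendsto_intros f(2) g(2))
  then have R: "R \<longlonglongrightarrow> 0"
    by simp
  have "\<bar>(\<integral>x. fs k x * gs k x \<partial>M) - (\<integral>x. f x * g x \<partial>M)\<bar> \<le> R k" for k
  proof -
    have ints: "integrable M (\<lambda>x. f x * c k x)" "integrable M (\<lambda>x. a k x * g x)"
      "integrable M (\<lambda>x. a k x * c k x)" "integrable M (\<lambda>x. f x * g x)"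
      using a c f(1) g(1) by (auto intro!: integrable_mult_square_integrable)
    have "fs k x * gs k x = f x * g x - f x * c k x - a k x * g x + a k x * c k x" for x
      by (simp add: a_def c_def algebra_simps)
    then have "(\<integral>x. fs k x * gs k x \<partial>M) = (\<integral>x. f x * g x - f x * c k x - a k x * g x + a k x * c k x \<partial>M)"
      by simp
    also have "\<dots> = (\<integral>x. f x * g x \<partial>M) - (\<integral>x. f x * c k x \<partial>M)
        - (\<integral>x. a k x * g x \<partial>M) + (\<integral>x. a k x * c k x \<partial>M)"
      using ints by simp
    moreover have "\<bar>\<integral>x. f x * c k x \<partial>M\<bar> \<le> sqrt (\<integral>x. (f x)\<^sup>2 \<partial>M) * sqrt (\<integral>x. (c k x)\<^sup>2 \<partial>M)"
      "\<bar>\<integral>x. a k x * g x \<partial>M\<bar> \<le> sqrt (\<integral>x. (a k x)\<^sup>2 \<partial>M) * sqrt (\<integral>x. (g x)\<^sup>2 \<partial>M)"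
      "\<bar>\<integral>x. a k x * c k x \<partial>M\<bar> \<le> sqrt (\<integral>x. (a k x)\<^sup>2 \<partial>M) * sqrt (\<integral>x. (c k x)\<^sup>2 \<partial>M)"
      using a c f(1) g(1) by (auto intro!: Cauchy_Schwarz_integral)
    ultimately show ?thesis
      unfolding R_def by linarith
  qed
  then have "(\<lambda>k. (\<integral>x. fs k x * gs k x \<partial>M) - (\<integral>x. f x * g x \<partial>M)) \<longlonglongrightarrow> 0"
    by (intro Lim_null_comparison[OF _ R]) simp
  then show ?thesis
    by (rule LIM_zero_cancel)
qed

section \<open>Increments of correlated Brownian motions\<close>

lemma integrable_bounded_mult:
  fixes f g :: "'a \<Rightarrow> real"
  assumes "f \<in> borel_measurable M" "\<exists>K. \<forall>x\<in>space M. \<bar>f x\<bar> \<le> K" "integrable M g"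
  shows "integrable M (\<lambda>x. f x * g x)"
proof -
  obtain K where K: "\<And>x. x \<in> space M \<Longrightarrow> \<bar>f x\<bar> \<le> K"
    using assms(2) by blast
  show ?thesis
  proof (rule Bochner_Integration.integrable_bound[of M "\<lambda>x. K * \<bar>g x\<bar>"])
    show "integrable M (\<lambda>x. K * \<bar>g x\<bar>)"
      using assms(3) by simp
    show "AE x in M. norm (f x * g x) \<le> norm (K * \<bar>g x\<bar>)"
    proof (rule AE_I2)
      fix x assume "x \<in> space M"
      then have "\<bar>f x\<bar> \<le> \<bar>K\<bar>"
        using K[of x] by linarith
      then show "norm (f x * g x) \<le> norm (K * \<bar>g x\<bar>)"
        by (simp add: abs_mult mult_right_mono)
    qed
  qed (use assms in measurable)
qed

lemma bounded_mult:
  fixes f g :: "'a \<Rightarrow> real"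
  assumes "\<exists>K. \<forall>x\<in>A. \<bar>f x\<bar> \<le> K" "\<exists>K. \<forall>x\<in>A. \<bar>g x\<bar> \<le> K"
  shows "\<exists>K. \<forall>x\<in>A. \<bar>f x * g x\<bar> \<le> K"
proof -
  obtain K L where K: "\<And>x. x \<in> A \<Longrightarrow> \<bar>f x\<bar> \<le> K" and L: "\<And>x. x \<in> A \<Longrightarrow> \<bar>g x\<bar> \<le> L"
    using assms by blast
  have "\<bar>f x * g x\<bar> \<le> K * L" if "x \<in> A" for x
    using mult_mono[OF K[OF that] L[OF that]] K[OF that] by (simp add: abs_mult)
  then show ?thesis by blast
qed

locale filtered_prob_space = prob_space M for M :: "'a measure" +
  fixes F :: "real \<Rightarrow> 'a measure"
  assumes filtration: "filtration (space M) F" and subalgebra_F: "\<And>t. subalgebra M (F t)"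
begin

lemma measurable_F_imp_M: "f \<in> borel_measurable (F t) \<Longrightarrow> f \<in> borel_measurable M"
  using subalgebra_F measurable_from_subalg by blast

lemma measurable_F_mono:
  assumes "f \<in> borel_measurable (F s)" "s \<le> t"
  shows "f \<in> borel_measurable (F t)"
proof -
  interpret filtration "space M" F by (rule filtration)
  have "subalgebra (F t) (F s)"
    using sets_F_mono[OF assms(2)] by (simp add: subalgebra_def space_F)
  then show ?thesis
    using assms(1) by (rule measurable_from_subalg)
qed

section \<open>Moments and independence of Brownian increments\<close>

context
  fixes W :: "real \<Rightarrow> 'a \<Rightarrow> real"
  assumes bm: "brownian_motion_wrt M F W"
begin

lemma bm_measurable_F: "0 \<le> t \<Longrightarrow> W t \<in> borel_measurable (F t)"
  using bm by (simp add: brownian_motion_wrt_def adapted_process_def)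

lemma bm_measurable: "0 \<le> t \<Longrightarrow> W t \<in> borel_measurable M"
  using bm_measurable_F measurable_F_imp_M by blast

lemma bm_increment_moments:
  assumes "0 \<le> s" "s \<le> t"
  shows "integrable M (\<lambda>\<omega>. W t \<omega> - W s \<omega>)" and "expectation (\<lambda>\<omega>. W t \<omega> - W s \<omega>) = 0"
    and "integrable M (\<lambda>\<omega>. (W t \<omega> - W s \<omega>)\<^sup>2)" and "expectation (\<lambda>\<omega>. (W t \<omega> - W s \<omega>)\<^sup>2) = t - s"
proof -
  have *: "integrable M (\<lambda>\<omega>. W t \<omega> - W s \<omega>) \<and> expectation (\<lambda>\<omega>. W t \<omega> - W s \<omega>) = 0
      \<and> integrable M (\<lambda>\<omega>. (W t \<omega> - W s \<omega>)\<^sup>2) \<and> expectation (\<lambda>\<omega>. (W t \<omega> - W s \<omega>)\<^sup>2) = t - s"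
  \<comment> \<open>The normal law is prescribed only for \<open>s < t\<close>; at
    \<open>s = t\<close> the increment is identically 0.\<close>
  proof (cases "s = t")
    case False
    then have st: "0 < sqrt (t - s)"
      using assms by simp
    have D: "distributed M lborel (\<lambda>\<omega>. W t \<omega> - W s \<omega>) (normal_density 0 (sqrt (t - s)))"
      using bm assms False by (simp add: brownian_motion_wrt_def brownian_motion_def)
    have 0: "expectation (\<lambda>\<omega>. W t \<omega> - W s \<omega>) = 0"
      by (rule normal_distributed_expectation[OF st D])
    have 1: "integrable M (\<lambda>\<omega>. W t \<omega> - W s \<omega>)"
      using distributed_integrable[OF D, of "\<lambda>x. x"] integrable_normal_moment[OF st, of 0 1] by simp
    have 2: "integrable M (\<lambda>\<omega>. (W t \<omega> - W s \<omega>)\<^sup>2)"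
      using distributed_integrable[OF D, of "\<lambda>x. x\<^sup>2"] integrable_normal_moment[OF st, of 0 2] by simp
    have "variance (\<lambda>\<omega>. W t \<omega> - W s \<omega>) = t - s"
      using normal_distributed_variance[OF st D] assms by simp
    then show ?thesis
      using 0 1 2 by simp
  qed simp
  then show "integrable M (\<lambda>\<omega>. W t \<omega> - W s \<omega>)" and "expectation (\<lambda>\<omega>. W t \<omega> - W s \<omega>) = 0"
    and "integrable M (\<lambda>\<omega>. (W t \<omega> - W s \<omega>)\<^sup>2)" and "expectation (\<lambda>\<omega>. (W t \<omega> - W s \<omega>)\<^sup>2) = t - s"
    by blast+
qed

lemma bm_square_integrable:
  assumes "0 \<le> t"
  shows "integrable M (\<lambda>\<omega>. (W t \<omega>)\<^sup>2)"
proof -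
  have "AE \<omega> in M. W 0 \<omega> = 0"
    using bm by (simp add: brownian_motion_wrt_def brownian_motion_def)
  then have "AE \<omega> in M. (W t \<omega> - W 0 \<omega>)\<^sup>2 = (W t \<omega>)\<^sup>2"
    by (rule eventually_mono) simp
  moreover have [measurable]: "W t \<in> borel_measurable M" "W 0 \<in> borel_measurable M"
    using assms by (auto intro: bm_measurable)
  ultimately show ?thesis
    using bm_increment_moments(3)[OF order_refl assms]
    by (subst integrable_cong_AE[where g = "\<lambda>\<omega>. (W t \<omega> - W 0 \<omega>)\<^sup>2"]) (auto elim: eventually_mono)
qed

text \<open>The sigma-algebra generated by \<open>\<zeta>\<close> lies inside \<open>F s\<close>,
  and the preimages of Borel sets under the increment already form a sigma-algebra, so independence
  of set systems becomes independence of random variables.\<close>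

lemma bm_increment_indep:
  assumes st: "0 \<le> s" "s \<le> t" and \<zeta>: "\<zeta> \<in> borel_measurable (F s)"
  shows "indep_var borel \<zeta> borel (\<lambda>\<omega>. W t \<omega> - W s \<omega>)"
proof -
  let ?D = "\<lambda>\<omega>. W t \<omega> - W s \<omega>"
  interpret filtration "space M" F by (rule filtration)
  have [measurable]: "W t \<in> borel_measurable M" "W s \<in> borel_measurable M" "\<zeta> \<in> borel_measurable M"
    using st \<zeta> by (auto intro: bm_measurable measurable_F_imp_M)
  have D: "?D \<in> borel_measurable M"
    by measurable
  have ind: "indep_set (sets (F s)) {?D -` A \<inter> space M | A. A \<in> sets borel}"
    using bm st by (simp add: brownian_motion_wrt_def)
  have sub1: "sigma_sets (space M) {\<zeta> -` A \<inter> space M | A. A \<in> sets borel} \<subseteq> sets (F s)"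
  proof -
    have "{\<zeta> -` A \<inter> space M | A. A \<in> sets borel} \<subseteq> sets (F s)"
      using measurable_sets[OF \<zeta>] by (auto simp: space_F)
    then show ?thesis
      using sets.sigma_sets_subset[of _ "F s"] by (simp add: space_F)
  qed
  have sub2: "sigma_sets (space M) {?D -` A \<inter> space M | A. A \<in> sets borel}
      = {?D -` A \<inter> space M | A. A \<in> sets borel}"
    using sigma_sets_vimage_commute[of ?D "space M" UNIV "sets borel"]
    by (simp add: sets.sigma_sets_eq[of borel, simplified])
  show ?thesis
    unfolding indep_var_eq sub2
  proof (intro conjI)
    show "indep_set (sigma_sets (space M) {\<zeta> -` A \<inter> space M | A. A \<in> sets borel})
        {?D -` A \<inter> space M | A. A \<in> sets borel}"
      using ind sub1 unfolding indep_sets2_eq by blast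
  qed (use D in measurable)
qed

text \<open>Integrability of \<open>\<zeta>\<close> rather than boundedness is assumed because the
  weights include products of a bounded variable with a Brownian value or with an earlier
  increment.\<close>

lemma expectation_mult_bm_increment:
  assumes "0 \<le> s" "s \<le> t" "\<zeta> \<in> borel_measurable (F s)" "integrable M \<zeta>"
  shows "integrable M (\<lambda>\<omega>. \<zeta> \<omega> * (W t \<omega> - W s \<omega>))"
    and "expectation (\<lambda>\<omega>. \<zeta> \<omega> * (W t \<omega> - W s \<omega>)) = 0"
  using indep_var_integrable[OF bm_increment_indep[OF assms(1-3)] assms(4) bm_increment_moments(1)[OF assms(1,2)]]
    indep_var_lebesgue_integral[OF bm_increment_indep[OF assms(1-3)] assms(4) bm_increment_moments(1)[OF assms(1,2)]]
    bm_increment_moments(2)[OF assms(1,2)]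
  by simp_all

lemma expectation_mult_bm_increment_square:
  assumes "0 \<le> s" "s \<le> t" "\<zeta> \<in> borel_measurable (F s)" "integrable M \<zeta>"
  shows "expectation (\<lambda>\<omega>. \<zeta> \<omega> * (W t \<omega> - W s \<omega>)\<^sup>2) = expectation \<zeta> * (t - s)"
proof -
  have "indep_var borel ((\<lambda>x. x) \<circ> \<zeta>) borel ((\<lambda>x. x\<^sup>2) \<circ> (\<lambda>\<omega>. W t \<omega> - W s \<omega>))"
    by (rule indep_var_compose[OF bm_increment_indep[OF assms(1-3)]]) measurable
  then have "indep_var borel \<zeta> borel (\<lambda>\<omega>. (W t \<omega> - W s \<omega>)\<^sup>2)"
    by (simp add: comp_def)
  then show ?thesis
    using indep_var_lebesgue_integral[OF _ assms(4) bm_increment_moments(3)[OF assms(1,2)]]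
      bm_increment_moments(4)[OF assms(1,2)]
    by simp
qed

end

text \<open>
  Stated as a conditional covariance of increments rather than as the martingale property, so that
  it applies to \<open>V = W\<close>, \<open>\<rho> = 1\<close> without a separate martingale proof.
\<close>

definition covariation :: "real \<Rightarrow> (real \<Rightarrow> 'a \<Rightarrow> real) \<Rightarrow> (real \<Rightarrow> 'a \<Rightarrow> real) \<Rightarrow> bool" where
  "covariation \<rho> V W \<longleftrightarrow> brownian_motion_wrt M F V \<and> brownian_motion_wrt M F W \<and>
    (\<forall>s t \<zeta>. 0 \<le> s \<longrightarrow> s \<le> t \<longrightarrow> \<zeta> \<in> borel_measurable (F s) \<longrightarrow> (\<exists>K. \<forall>\<omega>\<in>space M. \<bar>\<zeta> \<omega>\<bar> \<le> K) \<longrightarrow>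
      expectation (\<lambda>\<omega>. \<zeta> \<omega> * ((V t \<omega> - V s \<omega>) * (W t \<omega> - W s \<omega>))) = \<rho> * (t - s) * expectation \<zeta>)"

lemma covariation_commute: "covariation \<rho> V W \<Longrightarrow> covariation \<rho> W V"
  unfolding covariation_def by (simp add: mult.commute)

lemma bounded_integrable:
  fixes \<zeta> :: "'a \<Rightarrow> real"
  assumes "\<zeta> \<in> borel_measurable M" "\<exists>K. \<forall>\<omega>\<in>space M. \<bar>\<zeta> \<omega>\<bar> \<le> K"
  shows "integrable M \<zeta>"
  using integrable_bounded_mult[OF assms, of "\<lambda>_. 1"] by simp

lemma covariation_self:
  assumes "brownian_motion_wrt M F W"
  shows "covariation 1 W W"
  unfolding covariation_def power2_eq_square[symmetric]
proof (intro conjI allI impI)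
  fix s t :: real and \<zeta> :: "'a \<Rightarrow> real"
  assume *: "0 \<le> s" "s \<le> t" "\<zeta> \<in> borel_measurable (F s)" "\<exists>K. \<forall>\<omega>\<in>space M. \<bar>\<zeta> \<omega>\<bar> \<le> K"
  then have "integrable M \<zeta>"
    by (intro bounded_integrable measurable_F_imp_M)
  then show "expectation (\<lambda>\<omega>. \<zeta> \<omega> * (W t \<omega> - W s \<omega>)\<^sup>2) = 1 * (t - s) * expectation \<zeta>"
    using expectation_mult_bm_increment_square[OF assms *(1-3)] by simp
qed (rule assms)+

text \<open>The product of increments is the increment of \<open>V * W\<close>, minus
  \<open>V s\<close> times the increment of \<open>W\<close>, minus \<open>W s\<close> times the
  increment of \<open>V\<close>. The last two average to 0 since \<open>V s\<close> and
  \<open>W s\<close> are known at time \<open>s\<close>; the martingale property evaluates the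
  first.\<close>

lemma covariation_correlated:
  assumes "correlated_brownian_motions M F \<rho> V W"
  shows "covariation \<rho> V W"
  unfolding covariation_def
proof (intro conjI allI impI)
  show V: "brownian_motion_wrt M F V" and W: "brownian_motion_wrt M F W"
    using assms by (simp_all add: correlated_brownian_motions_def)
  have mart: "martingale M F (\<lambda>t \<omega>. V t \<omega> * W t \<omega> - \<rho> * t)"
    using assms by (simp add: correlated_brownian_motions_def)
  fix s t :: real and \<zeta> :: "'a \<Rightarrow> real"
  assume st: "0 \<le> s" "s \<le> t" and \<zeta>: "\<zeta> \<in> borel_measurable (F s)"
    and bdd: "\<exists>K. \<forall>\<omega>\<in>space M. \<bar>\<zeta> \<omega>\<bar> \<le> K"
  have t: "0 \<le> t" using st by simp
  interpret sub: finite_measure_subalgebra M "F s"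
    by unfold_locales (rule subalgebra_F)
  have \<zeta>M: "\<zeta> \<in> borel_measurable M"
    using \<zeta> by (rule measurable_F_imp_M)
  note [measurable] = \<zeta>M bm_measurable[OF V st(1)] bm_measurable[OF V t] bm_measurable[OF W st(1)]
    bm_measurable[OF W t]
  let ?Q = "\<lambda>t \<omega>. V t \<omega> * W t \<omega> - \<rho> * t"
  have Q: "integrable M (?Q t)" "integrable M (?Q s)"
    and ce: "AE \<omega> in M. real_cond_exp M (F s) (?Q t) \<omega> = ?Q s \<omega>"
    using mart st t by (auto simp: martingale_def)
  have \<zeta>Q: "integrable M (\<lambda>\<omega>. \<zeta> \<omega> * ?Q t \<omega>)" "integrable M (\<lambda>\<omega>. \<zeta> \<omega> * ?Q s \<omega>)"
    using Q by (auto intro!: integrable_bounded_mult[OF \<zeta>M bdd])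
  \<comment> \<open>A bounded weight measurable for \<open>F s\<close> passes through the
    conditional expectation, so the martingale property can be tested against
    \<open>\<zeta>\<close>.\<close>
  have "expectation (\<lambda>\<omega>. \<zeta> \<omega> * ?Q t \<omega>) = expectation (\<lambda>\<omega>. \<zeta> \<omega> * real_cond_exp M (F s) (?Q t) \<omega>)"
    using sub.real_cond_exp_intg(2)[OF \<zeta>Q(1) \<zeta>] by simp
  also have "\<dots> = expectation (\<lambda>\<omega>. \<zeta> \<omega> * ?Q s \<omega>)"
    using ce by (intro integral_cong_AE) (auto elim: eventually_mono)
  finally have EQ: "expectation (\<lambda>\<omega>. \<zeta> \<omega> * ?Q t \<omega>) = expectation (\<lambda>\<omega>. \<zeta> \<omega> * ?Q s \<omega>)" .
  have \<zeta>I: "integrable M \<zeta>"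
    by (rule bounded_integrable[OF \<zeta>M bdd])
  have Vs: "(\<lambda>\<omega>. \<zeta> \<omega> * V s \<omega>) \<in> borel_measurable (F s)" "integrable M (\<lambda>\<omega>. \<zeta> \<omega> * V s \<omega>)"
    and Ws: "(\<lambda>\<omega>. \<zeta> \<omega> * W s \<omega>) \<in> borel_measurable (F s)" "integrable M (\<lambda>\<omega>. \<zeta> \<omega> * W s \<omega>)"
    using \<zeta> bm_measurable_F[OF V st(1)] bm_measurable_F[OF W st(1)]
      bm_square_integrable[OF V st(1)] bm_square_integrable[OF W st(1)]
    by (auto intro!: integrable_bounded_mult[OF \<zeta>M bdd] square_integrable_imp_integrable)
  note VW = expectation_mult_bm_increment[OF W st Vs] and WV = expectation_mult_bm_increment[OF V st Ws]
  have "\<zeta> \<omega> * ((V t \<omega> - V s \<omega>) * (W t \<omega> - W s \<omega>))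
      = \<zeta> \<omega> * ?Q t \<omega> - \<zeta> \<omega> * ?Q s \<omega> - \<zeta> \<omega> * V s \<omega> * (W t \<omega> - W s \<omega>)
        - \<zeta> \<omega> * W s \<omega> * (V t \<omega> - V s \<omega>) + \<rho> * (t - s) * \<zeta> \<omega>" for \<omega>
    by (simp add: algebra_simps)
  then have "expectation (\<lambda>\<omega>. \<zeta> \<omega> * ((V t \<omega> - V s \<omega>) * (W t \<omega> - W s \<omega>)))
      = expectation (\<lambda>\<omega>. \<zeta> \<omega> * ?Q t \<omega> - \<zeta> \<omega> * ?Q s \<omega> - \<zeta> \<omega> * V s \<omega> * (W t \<omega> - W s \<omega>)
        - \<zeta> \<omega> * W s \<omega> * (V t \<omega> - V s \<omega>) + \<rho> * (t - s) * \<zeta> \<omega>)"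
    by simp
  also have "\<dots> = expectation (\<lambda>\<omega>. \<zeta> \<omega> * ?Q t \<omega>) - expectation (\<lambda>\<omega>. \<zeta> \<omega> * ?Q s \<omega>)
      - expectation (\<lambda>\<omega>. \<zeta> \<omega> * V s \<omega> * (W t \<omega> - W s \<omega>))
      - expectation (\<lambda>\<omega>. \<zeta> \<omega> * W s \<omega> * (V t \<omega> - V s \<omega>)) + \<rho> * (t - s) * expectation \<zeta>"
    by (subst Bochner_Integration.integral_add Bochner_Integration.integral_diff;
        (intro Bochner_Integration.integrable_diff Bochner_Integration.integrable_add
          integrable_mult_right \<zeta>Q VW(1) WV(1) \<zeta>I)?)+ (rule refl | simp)
  finally show "expectation (\<lambda>\<omega>. \<zeta> \<omega> * ((V t \<omega> - V s \<omega>) * (W t \<omega> - W s \<omega>))) = \<rho> * (t - s) * expectation \<zeta>"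
    using EQ VW(2) WV(2) by simp
qed

lemma covariation_integrable:
  assumes "covariation \<rho> V W" and a: "0 \<le> a" "a \<le> b" and c: "0 \<le> c" "c \<le> d"
    and \<zeta>: "\<zeta> \<in> borel_measurable M" "\<exists>K. \<forall>\<omega>\<in>space M. \<bar>\<zeta> \<omega>\<bar> \<le> K"
  shows "integrable M (\<lambda>\<omega>. \<zeta> \<omega> * ((V b \<omega> - V a \<omega>) * (W d \<omega> - W c \<omega>)))"
proof (rule integrable_bounded_mult[OF \<zeta>], rule integrable_mult_square_integrable)
  have bm: "brownian_motion_wrt M F V" "brownian_motion_wrt M F W"
    using assms(1) by (simp_all add: covariation_def)
  show "integrable M (\<lambda>\<omega>. (V b \<omega> - V a \<omega>)\<^sup>2)" "integrable M (\<lambda>\<omega>. (W d \<omega> - W c \<omega>)\<^sup>2)"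
    using bm a c by (auto intro: bm_increment_moments)
  have "V a \<in> borel_measurable M" "V b \<in> borel_measurable M"
    "W c \<in> borel_measurable M" "W d \<in> borel_measurable M"
    using bm a c by (auto intro: bm_measurable)
  then show "(\<lambda>\<omega>. V b \<omega> - V a \<omega>) \<in> borel_measurable M" "(\<lambda>\<omega>. W d \<omega> - W c \<omega>) \<in> borel_measurable M"
    by measurable
qed

text \<open>The factor next to \<open>\<rho>\<close> is the length of the overlap of the two time
  intervals. Cutting at endpoints leaves pieces that coincide or are ordered in time: the former are
  covered by \<open>covariation\<close>, the latter contribute 0 because the later increment is
  independent of the past and centred. This takes the place of a common refinement of two
  partitions.\<close>

lemma covariation_increments_le:
  assumes cov: "covariation \<rho> V W" and a: "0 \<le> a" "a \<le> b" and c: "a \<le> c" "c \<le> d"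
    and \<zeta>: "\<zeta> \<in> borel_measurable (F c)" "\<exists>K. \<forall>\<omega>\<in>space M. \<bar>\<zeta> \<omega>\<bar> \<le> K"
  shows "expectation (\<lambda>\<omega>. \<zeta> \<omega> * ((V b \<omega> - V a \<omega>) * (W d \<omega> - W c \<omega>)))
    = \<rho> * max 0 (min b d - c) * expectation \<zeta>"
proof -
  have V: "brownian_motion_wrt M F V" and W: "brownian_motion_wrt M F W"
    using cov by (simp_all add: covariation_def)
  have c0: "0 \<le> c" using a c by simp
  have \<zeta>M: "\<zeta> \<in> borel_measurable M"
    using \<zeta>(1) by (rule measurable_F_imp_M)
  \<comment> \<open>In \<open>before\<close> the \<open>V\<close>-increment comes first, in
    \<open>after\<close> the \<open>W\<close>-increment. The earlier increment joins the weight,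
    which must be known when the later one starts.\<close>
  have before: "expectation (\<lambda>\<omega>. \<zeta> \<omega> * ((V q \<omega> - V p \<omega>) * (W s \<omega> - W r \<omega>))) = 0"
    if pq: "0 \<le> p" "p \<le> q" "q \<le> r" "c \<le> r" "r \<le> s" for p q r s
  proof -
    have r: "0 \<le> r" "0 \<le> q" using pq by auto
    have "V p \<in> borel_measurable (F r)" "V q \<in> borel_measurable (F r)" "\<zeta> \<in> borel_measurable (F r)"
      using pq r measurable_F_mono[OF bm_measurable_F[OF V]] measurable_F_mono[OF \<zeta>(1)] by auto
    then have m: "(\<lambda>\<omega>. \<zeta> \<omega> * (V q \<omega> - V p \<omega>)) \<in> borel_measurable (F r)"
      by measurable
    have "integrable M (\<lambda>\<omega>. \<zeta> \<omega> * (V q \<omega> - V p \<omega>))"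
      using bm_increment_moments(1)[OF V pq(1,2)] by (intro integrable_bounded_mult \<zeta>M \<zeta>(2))
    from expectation_mult_bm_increment(2)[OF W r(1) pq(5) m this] show ?thesis
      by (simp add: mult.assoc)
  qed
  have after: "expectation (\<lambda>\<omega>. \<zeta> \<omega> * ((V s \<omega> - V r \<omega>) * (W q \<omega> - W p \<omega>))) = 0"
    if pq: "c \<le> p" "p \<le> q" "q \<le> r" "r \<le> s" for p q r s
  proof -
    have r: "0 \<le> r" "0 \<le> q" "0 \<le> p" using pq c0 by auto
    have "W p \<in> borel_measurable (F r)" "W q \<in> borel_measurable (F r)" "\<zeta> \<in> borel_measurable (F r)"
      using pq r measurable_F_mono[OF bm_measurable_F[OF W]] measurable_F_mono[OF \<zeta>(1)] by auto
    then have m: "(\<lambda>\<omega>. \<zeta> \<omega> * (W q \<omega> - W p \<omega>)) \<in> borel_measurable (F r)"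
      by measurable
    have "integrable M (\<lambda>\<omega>. \<zeta> \<omega> * (W q \<omega> - W p \<omega>))"
      using bm_increment_moments(1)[OF W r(3) pq(2)] by (intro integrable_bounded_mult \<zeta>M \<zeta>(2))
    from expectation_mult_bm_increment(2)[OF V r(1) pq(4) m this] show ?thesis
      by (simp add: mult_ac)
  qed
  have same: "expectation (\<lambda>\<omega>. \<zeta> \<omega> * ((V q \<omega> - V c \<omega>) * (W q \<omega> - W c \<omega>))) = \<rho> * (q - c) * expectation \<zeta>"
    if "c \<le> q" for q
    using cov c0 that \<zeta> unfolding covariation_def by blast
  have int: "integrable M (\<lambda>\<omega>. \<zeta> \<omega> * ((V q \<omega> - V p \<omega>) * (W s \<omega> - W r \<omega>)))"
    if "0 \<le> p" "p \<le> q" "0 \<le> r" "r \<le> s" for p q r s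
    by (rule covariation_integrable[OF cov that \<zeta>M \<zeta>(2)])
  show ?thesis
  proof (cases "b \<le> c")
    case True
    then show ?thesis
      using before[OF a True order_refl c(2)] by (simp add: max_def min_def)
  next
    case False
    then have cb: "c \<le> b" by simp
    \<comment> \<open>The part of the \<open>V\<close>-increment before \<open>c\<close> drops out,
      so both intervals may be taken to start at \<open>c\<close>.\<close>
    have "expectation (\<lambda>\<omega>. \<zeta> \<omega> * ((V b \<omega> - V a \<omega>) * (W d \<omega> - W c \<omega>)))
      = expectation (\<lambda>\<omega>. \<zeta> \<omega> * ((V c \<omega> - V a \<omega>) * (W d \<omega> - W c \<omega>))
          + \<zeta> \<omega> * ((V b \<omega> - V c \<omega>) * (W d \<omega> - W c \<omega>)))"
      by (intro Bochner_Integration.integral_cong refl) (simp add: algebra_simps)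
    also have "\<dots> = expectation (\<lambda>\<omega>. \<zeta> \<omega> * ((V b \<omega> - V c \<omega>) * (W d \<omega> - W c \<omega>)))"
      using before[OF a(1) c(1) order_refl order_refl c(2)]
      by (subst Bochner_Integration.integral_add[OF int[OF a(1) c(1) c0 c(2)] int[OF c0 cb c0 c(2)]]) simp
    also have "\<dots> = \<rho> * (min b d - c) * expectation \<zeta>"
    proof (cases "b \<le> d")
      case True
      have b0: "0 \<le> b" using c0 cb by simp
      have "expectation (\<lambda>\<omega>. \<zeta> \<omega> * ((V b \<omega> - V c \<omega>) * (W d \<omega> - W c \<omega>)))
        = expectation (\<lambda>\<omega>. \<zeta> \<omega> * ((V b \<omega> - V c \<omega>) * (W b \<omega> - W c \<omega>))
          + \<zeta> \<omega> * ((V b \<omega> - V c \<omega>) * (W d \<omega> - W b \<omega>)))"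
        by (intro Bochner_Integration.integral_cong refl) (simp add: algebra_simps)
      also have "\<dots> = \<rho> * (b - c) * expectation \<zeta>"
        using before[OF c0 cb order_refl cb True] same[OF cb]
        by (subst Bochner_Integration.integral_add[OF int[OF c0 cb c0 cb] int[OF c0 cb b0 True]]) simp
      finally show ?thesis
        using True by (simp add: min_def)
    next
      case False
      then have db: "d \<le> b" by simp
      have d0: "0 \<le> d" using c0 c(2) by simp
      have "expectation (\<lambda>\<omega>. \<zeta> \<omega> * ((V b \<omega> - V c \<omega>) * (W d \<omega> - W c \<omega>)))
        = expectation (\<lambda>\<omega>. \<zeta> \<omega> * ((V d \<omega> - V c \<omega>) * (W d \<omega> - W c \<omega>))
          + \<zeta> \<omega> * ((V b \<omega> - V d \<omega>) * (W d \<omega> - W c \<omega>)))"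
        by (intro Bochner_Integration.integral_cong refl) (simp add: algebra_simps)
      also have "\<dots> = \<rho> * (d - c) * expectation \<zeta>"
        using after[OF order_refl c(2) order_refl db] same[OF c(2)]
        by (subst Bochner_Integration.integral_add[OF int[OF c0 c(2) c0 c(2)] int[OF d0 db c0 c(2)]]) simp
      finally show ?thesis
        using db by (simp add: min_def)
    qed
    finally show ?thesis
      using cb c(2) by (simp add: max_def min_def)
  qed
qed

text \<open>The product of the two weights is known at the later of the two left endpoints, and
  exchanging \<open>V\<close> and \<open>W\<close> reduces the case \<open>c \<le> a\<close> to the
  other one.\<close>

lemma covariation_increments:
  assumes cov: "covariation \<rho> V W" and a: "0 \<le> a" "a \<le> b" and c: "0 \<le> c" "c \<le> d"
    and \<xi>: "\<xi> \<in> borel_measurable (F a)" "\<exists>K. \<forall>\<omega>\<in>space M. \<bar>\<xi> \<omega>\<bar> \<le> K"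
    and \<eta>: "\<eta> \<in> borel_measurable (F c)" "\<exists>K. \<forall>\<omega>\<in>space M. \<bar>\<eta> \<omega>\<bar> \<le> K"
  shows "expectation (\<lambda>\<omega>. (\<xi> \<omega> * (V b \<omega> - V a \<omega>)) * (\<eta> \<omega> * (W d \<omega> - W c \<omega>)))
    = \<rho> * (expectation (\<lambda>\<omega>. \<xi> \<omega> * \<eta> \<omega>) * max 0 (min b d - max a c))"
proof -
  let ?\<zeta> = "\<lambda>\<omega>. \<xi> \<omega> * \<eta> \<omega>"
  have bdd: "\<exists>K. \<forall>\<omega>\<in>space M. \<bar>?\<zeta> \<omega>\<bar> \<le> K"
    by (rule bounded_mult[OF \<xi>(2) \<eta>(2)])
  show ?thesis
  proof (cases "a \<le> c")
    case True
    have [measurable]: "\<xi> \<in> borel_measurable (F c)" "\<eta> \<in> borel_measurable (F c)"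
      using measurable_F_mono[OF \<xi>(1) True] \<eta>(1) .
    have "?\<zeta> \<in> borel_measurable (F c)"
      by measurable
    from covariation_increments_le[OF cov a True c(2) this bdd] show ?thesis
      using True by (simp add: mult_ac max_def)
  next
    case False
    then have ca: "c \<le> a" by simp
    have [measurable]: "\<xi> \<in> borel_measurable (F a)" "\<eta> \<in> borel_measurable (F a)"
      using \<xi>(1) measurable_F_mono[OF \<eta>(1) ca] .
    have "?\<zeta> \<in> borel_measurable (F a)"
      by measurable
    from covariation_increments_le[OF covariation_commute[OF cov] c ca a(2) this bdd] show ?thesis
      using ca by (simp add: mult_ac max_def min.commute)
  qed
qed

section \<open>Simple stochastic integrals\<close>

lemma simple_integrand_le:
  assumes "simple_integrand M F T n t \<xi>" "i \<le> j" "j \<le> n"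
  shows "t i \<le> t j"
  using assms(2,3)
proof (induction j rule: dec_induct)
  case (step m)
  then have "t i \<le> t m" "t m \<le> t (Suc m)"
    using assms(1) by (simp_all add: simple_integrand_def)
  then show ?case
    by (rule order_trans)
qed simp

lemma simple_integrandD:
  assumes "simple_integrand M F T n t \<xi>" "i < n"
  shows "0 \<le> t i" "t i \<le> t (Suc i)" "t (Suc i) \<le> T" "\<xi> i \<in> borel_measurable (F (t i))"
    "\<exists>K. \<forall>\<omega>\<in>space M. \<bar>\<xi> i \<omega>\<bar> \<le> K" "\<xi> i \<in> borel_measurable M"
proof -
  show *: "t i \<le> t (Suc i)" "\<xi> i \<in> borel_measurable (F (t i))" "\<exists>K. \<forall>\<omega>\<in>space M. \<bar>\<xi> i \<omega>\<bar> \<le> K"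
    using assms by (auto simp: simple_integrand_def)
  show "\<xi> i \<in> borel_measurable M"
    using *(2) by (rule measurable_F_imp_M)
  show "0 \<le> t i" "t (Suc i) \<le> T"
    using simple_integrand_le[OF assms(1), of 0 i] simple_integrand_le[OF assms(1), of "Suc i" n] assms
    by (auto simp: simple_integrand_def)
qed

lemma simple_integral_term:
  assumes bm: "brownian_motion_wrt M F W" and \<xi>: "simple_integrand M F T n t \<xi>" and i: "i < n"
  shows "(\<lambda>\<omega>. \<xi> i \<omega> * (W (t (Suc i)) \<omega> - W (t i) \<omega>)) \<in> borel_measurable M"
    and "integrable M (\<lambda>\<omega>. (\<xi> i \<omega> * (W (t (Suc i)) \<omega> - W (t i) \<omega>))\<^sup>2)"
    and "integrable M (\<lambda>\<omega>. \<xi> i \<omega> * (W (t (Suc i)) \<omega> - W (t i) \<omega>))"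
    and "expectation (\<lambda>\<omega>. \<xi> i \<omega> * (W (t (Suc i)) \<omega> - W (t i) \<omega>)) = 0"
proof -
  note s = simple_integrandD[OF \<xi> i]
  have [measurable]: "W (t i) \<in> borel_measurable M" "W (t (Suc i)) \<in> borel_measurable M" "\<xi> i \<in> borel_measurable M"
    using bm_measurable[OF bm] s by auto
  show "(\<lambda>\<omega>. \<xi> i \<omega> * (W (t (Suc i)) \<omega> - W (t i) \<omega>)) \<in> borel_measurable M"
    by measurable
  have "integrable M (\<lambda>\<omega>. (\<xi> i \<omega> * \<xi> i \<omega>) * (W (t (Suc i)) \<omega> - W (t i) \<omega>)\<^sup>2)"
    using s bm_increment_moments(3)[OF bm s(1,2)]
    by (intro integrable_bounded_mult bounded_mult) auto
  then show "integrable M (\<lambda>\<omega>. (\<xi> i \<omega> * (W (t (Suc i)) \<omega> - W (t i) \<omega>))\<^sup>2)"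
    by (simp add: power2_eq_square mult_ac)
  show "integrable M (\<lambda>\<omega>. \<xi> i \<omega> * (W (t (Suc i)) \<omega> - W (t i) \<omega>))"
    "expectation (\<lambda>\<omega>. \<xi> i \<omega> * (W (t (Suc i)) \<omega> - W (t i) \<omega>)) = 0"
    using expectation_mult_bm_increment[OF bm s(1,2,4) bounded_integrable[OF s(6,5)]] .
qed

lemma integrable_square_sum:
  fixes f :: "nat \<Rightarrow> 'b \<Rightarrow> real"
  assumes "\<And>i. i < n \<Longrightarrow> f i \<in> borel_measurable N" "\<And>i. i < n \<Longrightarrow> integrable N (\<lambda>x. (f i x)\<^sup>2)"
  shows "integrable N (\<lambda>x. (\<Sum>i<n. f i x)\<^sup>2)"
  using assms by (induction n) (auto intro!: integrable_square_add borel_measurable_sum)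

lemma simple_integral:
  assumes bm: "brownian_motion_wrt M F W" and \<xi>: "simple_integrand M F T n t \<xi>"
  shows "simple_integral_wrt W n t \<xi> \<in> borel_measurable M"
    and "integrable M (\<lambda>\<omega>. (simple_integral_wrt W n t \<xi> \<omega>)\<^sup>2)"
    and "expectation (simple_integral_wrt W n t \<xi>) = 0"
proof -
  note s = simple_integral_term[OF bm \<xi>]
  show "simple_integral_wrt W n t \<xi> \<in> borel_measurable M"
    unfolding simple_integral_wrt_def[abs_def] using s(1) by (intro borel_measurable_sum) auto
  show "integrable M (\<lambda>\<omega>. (simple_integral_wrt W n t \<xi> \<omega>)\<^sup>2)"
    unfolding simple_integral_wrt_def using s(1,2) by (rule integrable_square_sum)
  show "expectation (simple_integral_wrt W n t \<xi>) = 0"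
    unfolding simple_integral_wrt_def[abs_def] using s(3,4)
    by (subst Bochner_Integration.integral_sum) auto
qed

text \<open>The result is left as a double sum over pairs of intervals because
  \<open>integral_simple_value_product\<close> produces exactly this expression; the isometry for
  simple integrands is the comparison of the two.\<close>

lemma expectation_simple_integral_product:
  assumes cov: "covariation \<rho> V W"
    and \<xi>: "simple_integrand M F T n t \<xi>" and \<eta>: "simple_integrand M F T m u \<eta>"
  shows "expectation (\<lambda>\<omega>. simple_integral_wrt V n t \<xi> \<omega> * simple_integral_wrt W m u \<eta> \<omega>)
    = \<rho> * (\<Sum>i<n. \<Sum>j<m. expectation (\<lambda>\<omega>. \<xi> i \<omega> * \<eta> j \<omega>)
        * max 0 (min (t (Suc i)) (u (Suc j)) - max (t i) (u j)))"
proof -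
  have V: "brownian_motion_wrt M F V" and W: "brownian_motion_wrt M F W"
    using cov by (simp_all add: covariation_def)
  have int: "integrable M (\<lambda>\<omega>. (\<xi> i \<omega> * (V (t (Suc i)) \<omega> - V (t i) \<omega>)) * (\<eta> j \<omega> * (W (u (Suc j)) \<omega> - W (u j) \<omega>)))"
    if "i < n" "j < m" for i j
    using simple_integral_term[OF V \<xi> that(1)] simple_integral_term[OF W \<eta> that(2)]
    by (intro integrable_mult_square_integrable)
  have "expectation (\<lambda>\<omega>. simple_integral_wrt V n t \<xi> \<omega> * simple_integral_wrt W m u \<eta> \<omega>)
    = expectation (\<lambda>\<omega>. \<Sum>i<n. \<Sum>j<m.
        (\<xi> i \<omega> * (V (t (Suc i)) \<omega> - V (t i) \<omega>)) * (\<eta> j \<omega> * (W (u (Suc j)) \<omega> - W (u j) \<omega>)))"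
    unfolding simple_integral_wrt_def by (simp only: sum_product)
  also have "\<dots> = (\<Sum>i<n. expectation (\<lambda>\<omega>. \<Sum>j<m.
        (\<xi> i \<omega> * (V (t (Suc i)) \<omega> - V (t i) \<omega>)) * (\<eta> j \<omega> * (W (u (Suc j)) \<omega> - W (u j) \<omega>))))"
    by (intro Bochner_Integration.integral_sum Bochner_Integration.integrable_sum int) auto
  also have "\<dots> = (\<Sum>i<n. \<Sum>j<m. expectation (\<lambda>\<omega>.
        (\<xi> i \<omega> * (V (t (Suc i)) \<omega> - V (t i) \<omega>)) * (\<eta> j \<omega> * (W (u (Suc j)) \<omega> - W (u j) \<omega>))))"
    by (intro sum.cong refl Bochner_Integration.integral_sum int) auto
  also have "\<dots> = (\<Sum>i<n. \<Sum>j<m. \<rho> * (expectation (\<lambda>\<omega>. \<xi> i \<omega> * \<eta> j \<omega>)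
        * max 0 (min (t (Suc i)) (u (Suc j)) - max (t i) (u j))))"
    by (intro sum.cong refl covariation_increments[OF cov])
      (auto intro: simple_integrandD[OF \<xi>] simple_integrandD[OF \<eta>])
  finally show ?thesis
    by (simp only: sum_distrib_left)
qed

end

section \<open>The Ito isometry and the moments of the prices\<close>

lemma (in pair_sigma_finite) integral_tensor_product:
  fixes g :: "'a \<Rightarrow> real" and k :: "'b \<Rightarrow> real"
  assumes g: "integrable M1 g" and k: "integrable M2 k"
  shows "integrable (M1 \<Otimes>\<^sub>M M2) (\<lambda>(x, y). g x * k y)"
    and "integral\<^sup>L (M1 \<Otimes>\<^sub>M M2) (\<lambda>(x, y). g x * k y) = integral\<^sup>L M1 g * integral\<^sup>L M2 k"
proof -
  have [measurable]: "g \<in> borel_measurable M1" "k \<in> borel_measurable M2"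
    using g k by auto
  show int: "integrable (M1 \<Otimes>\<^sub>M M2) (\<lambda>(x, y). g x * k y)"
  proof (rule Fubini_integrable)
    show "integrable M1 (\<lambda>x. \<integral>y. norm (case (x, y) of (x, y) \<Rightarrow> g x * k y) \<partial>M2)"
      using g by (simp add: abs_mult)
    show "AE x in M1. integrable M2 (\<lambda>y. case (x, y) of (x, y) \<Rightarrow> g x * k y)"
      using k by simp
  qed measurable
  show "integral\<^sup>L (M1 \<Otimes>\<^sub>M M2) (\<lambda>(x, y). g x * k y) = integral\<^sup>L M1 g * integral\<^sup>L M2 k"
    using integral_fst'[OF int] by simp
qed

text \<open>The overlap lengths on the integrand side: a product of indicators is the indicator of
  the intersection, and \<open>max 0\<close> covers disjoint intervals.\<close>

lemma integral_indicator_Ioc_mult: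
  fixes a b c d :: real
  shows "integrable lborel (\<lambda>s. indicator {a<..b} s * indicator {c<..d} s :: real)"
    and "(\<integral>s. indicator {a<..b} s * indicator {c<..d} s \<partial>lborel) = max 0 (min b d - max a c)"
proof -
  have eq: "indicator {a<..b} s * indicator {c<..d} s = (indicator {max a c<..min b d} s :: real)" for s
    by (auto simp: indicator_def)
  have Ioc: "emeasure lborel {l<..r} < \<infinity>" "measure lborel {l<..r} = max 0 (r - l)" for l r :: real
    by (cases "l \<le> r"; simp)+
  show "integrable lborel (\<lambda>s. indicator {a<..b} s * indicator {c<..d} s :: real)"
    unfolding eq by (intro integrable_real_indicator Ioc) simp
  show "(\<integral>s. indicator {a<..b} s * indicator {c<..d} s \<partial>lborel) = max 0 (min b d - max a c)"
    unfolding eq using Ioc(2)[of "max a c" "min b d"] by simp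
qed

section \<open>Integrands on the product space and the isometry\<close>

context filtered_prob_space
begin

sublocale M_lborel: pair_sigma_finite M lborel
  by unfold_locales

lemma simple_value_term:
  assumes \<xi>: "simple_integrand M F T n t \<xi>" and i: "i < n"
  shows "(\<lambda>(\<omega>, s). \<xi> i \<omega> * indicator {t i<..t (Suc i)} s) \<in> borel_measurable (M \<Otimes>\<^sub>M lborel)"
    and "integrable (M \<Otimes>\<^sub>M lborel) (\<lambda>x. ((\<lambda>(\<omega>, s). \<xi> i \<omega> * indicator {t i<..t (Suc i)} s) x)\<^sup>2)"
proof -
  note s = simple_integrandD[OF \<xi> i]
  have [measurable]: "\<xi> i \<in> borel_measurable M"
    by (rule s)
  show "(\<lambda>(\<omega>, s). \<xi> i \<omega> * indicator {t i<..t (Suc i)} s) \<in> borel_measurable (M \<Otimes>\<^sub>M lborel)"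
    by measurable
  have "integrable M (\<lambda>\<omega>. \<xi> i \<omega> * \<xi> i \<omega>)"
    using s by (intro integrable_bounded_mult bounded_integrable) auto
  from M_lborel.integral_tensor_product(1)[OF this integral_indicator_Ioc_mult(1)[of "t i" "t (Suc i)" "t i" "t (Suc i)"]]
  show "integrable (M \<Otimes>\<^sub>M lborel) (\<lambda>x. ((\<lambda>(\<omega>, s). \<xi> i \<omega> * indicator {t i<..t (Suc i)} s) x)\<^sup>2)"
    by (simp add: power2_eq_square case_prod_beta' mult_ac)
qed

lemma simple_value_measurable:
  assumes \<xi>: "simple_integrand M F T n t \<xi>"
  shows "(\<lambda>(\<omega>, s). simple_value n t \<xi> s \<omega>) \<in> borel_measurable (M \<Otimes>\<^sub>M lborel)"
    and "integrable (M \<Otimes>\<^sub>M lborel) (\<lambda>x. ((\<lambda>(\<omega>, s). simple_value n t \<xi> s \<omega>) x)\<^sup>2)"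
proof -
  have eq: "(\<lambda>(\<omega>, s). simple_value n t \<xi> s \<omega>)
      = (\<lambda>x. \<Sum>i<n. (\<lambda>(\<omega>, s). \<xi> i \<omega> * indicator {t i<..t (Suc i)} s) x)"
    by (simp add: fun_eq_iff simple_value_def)
  show "(\<lambda>(\<omega>, s). simple_value n t \<xi> s \<omega>) \<in> borel_measurable (M \<Otimes>\<^sub>M lborel)"
    unfolding eq by (intro borel_measurable_sum simple_value_term[OF \<xi>]) simp
  show "integrable (M \<Otimes>\<^sub>M lborel) (\<lambda>x. ((\<lambda>(\<omega>, s). simple_value n t \<xi> s \<omega>) x)\<^sup>2)"
    unfolding eq by (intro integrable_square_sum simple_value_term[OF \<xi>])
qed

lemma integral_simple_value_product:
  assumes \<xi>: "simple_integrand M F T n t \<xi>" and \<eta>: "simple_integrand M F T m u \<eta>"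
  shows "(\<integral>x. (\<lambda>(\<omega>, s). simple_value n t \<xi> s \<omega>) x * (\<lambda>(\<omega>, s). simple_value m u \<eta> s \<omega>) x \<partial>(M \<Otimes>\<^sub>M lborel))
    = (\<Sum>i<n. \<Sum>j<m. expectation (\<lambda>\<omega>. \<xi> i \<omega> * \<eta> j \<omega>)
        * max 0 (min (t (Suc i)) (u (Suc j)) - max (t i) (u j)))"
proof -
  define f where "f i j = (\<lambda>(\<omega>, s). (\<xi> i \<omega> * \<eta> j \<omega>)
    * (indicator {t i<..t (Suc i)} s * indicator {u j<..u (Suc j)} s :: real))" for i j
  have int: "integrable M (\<lambda>\<omega>. \<xi> i \<omega> * \<eta> j \<omega>)" if "i < n" "j < m" for i j
    using simple_integrandD[OF \<xi> that(1)] simple_integrandD[OF \<eta> that(2)]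
    by (intro integrable_bounded_mult bounded_integrable) auto
  have f: "integrable (M \<Otimes>\<^sub>M lborel) (f i j)"
    "integral\<^sup>L (M \<Otimes>\<^sub>M lborel) (f i j) = expectation (\<lambda>\<omega>. \<xi> i \<omega> * \<eta> j \<omega>)
        * max 0 (min (t (Suc i)) (u (Suc j)) - max (t i) (u j))" if "i < n" "j < m" for i j
    using M_lborel.integral_tensor_product[OF int[OF that] integral_indicator_Ioc_mult(1)]
    unfolding f_def integral_indicator_Ioc_mult(2) by auto
  have "(\<integral>x. (\<lambda>(\<omega>, s). simple_value n t \<xi> s \<omega>) x * (\<lambda>(\<omega>, s). simple_value m u \<eta> s \<omega>) x \<partial>(M \<Otimes>\<^sub>M lborel))
      = (\<integral>x. (\<Sum>i<n. \<Sum>j<m. f i j x) \<partial>(M \<Otimes>\<^sub>M lborel))"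
    unfolding case_prod_beta' simple_value_def f_def sum_product
    by (intro Bochner_Integration.integral_cong sum.cong refl) (simp only: mult_ac)
  also have "\<dots> = (\<Sum>i<n. \<integral>x. (\<Sum>j<m. f i j x) \<partial>(M \<Otimes>\<^sub>M lborel))"
    by (intro Bochner_Integration.integral_sum Bochner_Integration.integrable_sum f) auto
  also have "\<dots> = (\<Sum>i<n. \<Sum>j<m. \<integral>x. f i j x \<partial>(M \<Otimes>\<^sub>M lborel))"
    by (intro sum.cong refl Bochner_Integration.integral_sum f) auto
  also have "\<dots> = (\<Sum>i<n. \<Sum>j<m. expectation (\<lambda>\<omega>. \<xi> i \<omega> * \<eta> j \<omega>)
        * max 0 (min (t (Suc i)) (u (Suc j)) - max (t i) (u j)))"
    by (intro sum.cong refl f) auto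
  finally show ?thesis .
qed

text \<open>The cutoff makes the mean-square distance over \<open>{0..T}\<close> an ordinary
  distance on the product of \<open>M\<close> with Lebesgue measure on the whole line, where the
  general mean-square lemmas apply.\<close>

definition cut_integrand :: "real \<Rightarrow> (real \<Rightarrow> 'a \<Rightarrow> real) \<Rightarrow> 'a \<times> real \<Rightarrow> real" where
  "cut_integrand T H = (\<lambda>(\<omega>, s). indicator {0..T} s * H s \<omega>)"

text \<open>Tonelli turns the iterated integral of \<open>has_ito_integral\<close> into an integral
  over the product space. Joint measurability is a separate assumption because
  \<open>has_ito_integral\<close> does not assert it.\<close>

lemma ito_approximation:
  assumes bm: "brownian_motion_wrt M F W" and ito: "has_ito_integral M F W H T I"
    and H: "cut_integrand T H \<in> borel_measurable (M \<Otimes>\<^sub>M lborel)"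
  shows "\<exists>(n :: nat \<Rightarrow> nat) t \<xi>. (\<forall>k. simple_integrand M F T (n k) (t k) (\<xi> k)) \<and>
    (\<lambda>k. \<integral>\<^sup>+x. ennreal ((cut_integrand T H x
        - (\<lambda>(\<omega>, s). simple_value (n k) (t k) (\<xi> k) s \<omega>) x)\<^sup>2) \<partial>(M \<Otimes>\<^sub>M lborel)) \<longlonglongrightarrow> 0 \<and>
    (\<lambda>k. \<integral>\<^sup>+\<omega>. ennreal ((I \<omega> - simple_integral_wrt W (n k) (t k) (\<xi> k) \<omega>)\<^sup>2) \<partial>M) \<longlonglongrightarrow> 0"
proof -
  from ito obtain n :: "nat \<Rightarrow> nat" and t \<xi> where \<xi>: "\<And>k. simple_integrand M F T (n k) (t k) (\<xi> k)"
    and lim: "(\<lambda>k. \<integral>\<^sup>+\<omega>. (\<integral>\<^sup>+s\<in>{0..T}. ennreal ((H s \<omega> - simple_value (n k) (t k) (\<xi> k) s \<omega>)\<^sup>2) \<partial>lborel) \<partial>M)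
          \<longlonglongrightarrow> 0"
    and I: "(\<lambda>k. \<integral>\<^sup>+\<omega>. ennreal ((I \<omega> - simple_integral_wrt W (n k) (t k) (\<xi> k) \<omega>)\<^sup>2) \<partial>M) \<longlonglongrightarrow> 0"
    unfolding has_ito_integral_def by blast
  have "(\<integral>\<^sup>+\<omega>. (\<integral>\<^sup>+s\<in>{0..T}. ennreal ((H s \<omega> - simple_value (n k) (t k) (\<xi> k) s \<omega>)\<^sup>2) \<partial>lborel) \<partial>M)
      = (\<integral>\<^sup>+x. ennreal ((cut_integrand T H x
        - (\<lambda>(\<omega>, s). simple_value (n k) (t k) (\<xi> k) s \<omega>) x)\<^sup>2) \<partial>(M \<Otimes>\<^sub>M lborel))" for k
  proof -
    \<comment> \<open>All intervals of a simple integrand lie in \<open>{0..T}\<close>, so cutting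
      off \<open>H\<close> alone reproduces the integral over that set.\<close>
    have outside: "simple_value (n k) (t k) (\<xi> k) s \<omega> = 0" if "s \<notin> {0..T}" for s \<omega>
      unfolding simple_value_def
    proof (intro sum.neutral ballI)
      fix i assume "i \<in> {..<n k}"
      then have "s \<notin> {t k i<..t k (Suc i)}"
        using simple_integrandD[OF \<xi>[of k], of i] that by auto
      then show "\<xi> k i \<omega> * indicator {t k i<..t k (Suc i)} s = 0"
        by simp
    qed
    note [measurable] = H simple_value_measurable(1)[OF \<xi>[of k]]
    have "(\<integral>\<^sup>+x. ennreal ((cut_integrand T H x
        - (\<lambda>(\<omega>, s). simple_value (n k) (t k) (\<xi> k) s \<omega>) x)\<^sup>2) \<partial>(M \<Otimes>\<^sub>M lborel))
      = (\<integral>\<^sup>+\<omega>. (\<integral>\<^sup>+s. ennreal ((cut_integrand T H (\<omega>, s)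
        - (\<lambda>(\<omega>, s). simple_value (n k) (t k) (\<xi> k) s \<omega>) (\<omega>, s))\<^sup>2) \<partial>lborel) \<partial>M)"
      by (rule lborel.nn_integral_fst[symmetric]) measurable
    also have "\<dots> = (\<integral>\<^sup>+\<omega>. (\<integral>\<^sup>+s\<in>{0..T}. ennreal ((H s \<omega> - simple_value (n k) (t k) (\<xi> k) s \<omega>)\<^sup>2) \<partial>lborel) \<partial>M)"
      by (intro nn_integral_cong) (auto simp: cut_integrand_def indicator_def outside)
    finally show ?thesis by simp
  qed
  with lim \<xi> I show ?thesis
    by (intro exI[of _ n] exI[of _ t] exI[of _ \<xi>]) simp
qed

lemma ito_integral_square_integrable:
  assumes bm: "brownian_motion_wrt M F W" and ito: "has_ito_integral M F W H T I"
    and H: "cut_integrand T H \<in> borel_measurable (M \<Otimes>\<^sub>M lborel)"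
  shows "I \<in> borel_measurable M" and "integrable M (\<lambda>\<omega>. (I \<omega>)\<^sup>2)" and "expectation I = 0"
    and "integrable (M \<Otimes>\<^sub>M lborel) (\<lambda>x. (cut_integrand T H x)\<^sup>2)"
proof -
  obtain n :: "nat \<Rightarrow> nat" and t and \<xi>
    where \<xi>: "\<And>k. simple_integrand M F T (n k) (t k) (\<xi> k)"
    and lim: "(\<lambda>k. \<integral>\<^sup>+x. ennreal ((cut_integrand T H x
        - (\<lambda>(\<omega>, s). simple_value (n k) (t k) (\<xi> k) s \<omega>) x)\<^sup>2) \<partial>(M \<Otimes>\<^sub>M lborel)) \<longlonglongrightarrow> 0"
    and I: "(\<lambda>k. \<integral>\<^sup>+\<omega>. ennreal ((I \<omega> - simple_integral_wrt W (n k) (t k) (\<xi> k) \<omega>)\<^sup>2) \<partial>M) \<longlonglongrightarrow> 0"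
    using ito_approximation[OF assms] by blast
  show I_meas: "I \<in> borel_measurable M"
    using ito by (simp add: has_ito_integral_def)
  note s = simple_integral[OF bm \<xi>]
  show "integrable M (\<lambda>\<omega>. (I \<omega>)\<^sup>2)"
    by (rule mean_square_limit(1)[OF I_meas s(1,2) I])
  show "integrable (M \<Otimes>\<^sub>M lborel) (\<lambda>x. (cut_integrand T H x)\<^sup>2)"
    by (rule mean_square_limit(1)[OF H simple_value_measurable[OF \<xi>] lim])
  \<comment> \<open>The mean is the inner product with the constant 1, hence the limit of the
    vanishing means of the simple integrals.\<close>
  have "(\<lambda>k. expectation (\<lambda>\<omega>. simple_integral_wrt W (n k) (t k) (\<xi> k) \<omega> * 1))
      \<longlonglongrightarrow> expectation (\<lambda>\<omega>. I \<omega> * 1)"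
    by (rule tendsto_mean_square_inner[OF I_meas s(1) _ _ s(2) _ I]) simp_all
  then show "expectation I = 0"
    by (simp add: s(3) LIMSEQ_const_iff)
qed

text \<open>Along the approximating sequences both sides are the same double sum times
  \<open>\<rho>\<close>, so uniqueness of limits gives the identity. The form with two integrals is
  what admits different driving Brownian motions.\<close>

lemma ito_isometry:
  assumes cov: "covariation \<rho> V W"
    and ito: "has_ito_integral M F V H T I" "has_ito_integral M F W K T J"
    and H: "cut_integrand T H \<in> borel_measurable (M \<Otimes>\<^sub>M lborel)"
    and K: "cut_integrand T K \<in> borel_measurable (M \<Otimes>\<^sub>M lborel)"
  shows "expectation (\<lambda>\<omega>. I \<omega> * J \<omega>)
    = \<rho> * (\<integral>x. cut_integrand T H x * cut_integrand T K x \<partial>(M \<Otimes>\<^sub>M lborel))"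
proof -
  have V: "brownian_motion_wrt M F V" and W: "brownian_motion_wrt M F W"
    using cov by (simp_all add: covariation_def)
  obtain n :: "nat \<Rightarrow> nat" and t and \<xi>
    where \<xi>: "\<And>k. simple_integrand M F T (n k) (t k) (\<xi> k)"
    and H_lim: "(\<lambda>k. \<integral>\<^sup>+x. ennreal ((cut_integrand T H x
        - (\<lambda>(\<omega>, s). simple_value (n k) (t k) (\<xi> k) s \<omega>) x)\<^sup>2) \<partial>(M \<Otimes>\<^sub>M lborel)) \<longlonglongrightarrow> 0"
    and I: "(\<lambda>k. \<integral>\<^sup>+\<omega>. ennreal ((I \<omega> - simple_integral_wrt V (n k) (t k) (\<xi> k) \<omega>)\<^sup>2) \<partial>M) \<longlonglongrightarrow> 0"
    using ito_approximation[OF V ito(1) H] by blast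
  obtain m :: "nat \<Rightarrow> nat" and u and \<eta>
    where \<eta>: "\<And>k. simple_integrand M F T (m k) (u k) (\<eta> k)"
    and K_lim: "(\<lambda>k. \<integral>\<^sup>+x. ennreal ((cut_integrand T K x
        - (\<lambda>(\<omega>, s). simple_value (m k) (u k) (\<eta> k) s \<omega>) x)\<^sup>2) \<partial>(M \<Otimes>\<^sub>M lborel)) \<longlonglongrightarrow> 0"
    and J: "(\<lambda>k. \<integral>\<^sup>+\<omega>. ennreal ((J \<omega> - simple_integral_wrt W (m k) (u k) (\<eta> k) \<omega>)\<^sup>2) \<partial>M) \<longlonglongrightarrow> 0"
    using ito_approximation[OF W ito(2) K] by blast
  have IJ: "I \<in> borel_measurable M" "J \<in> borel_measurable M"
    using ito by (simp_all add: has_ito_integral_def)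
  have left: "(\<lambda>k. expectation (\<lambda>\<omega>. simple_integral_wrt V (n k) (t k) (\<xi> k) \<omega>
      * simple_integral_wrt W (m k) (u k) (\<eta> k) \<omega>)) \<longlonglongrightarrow> expectation (\<lambda>\<omega>. I \<omega> * J \<omega>)"
    by (rule tendsto_mean_square_inner[OF IJ(1) simple_integral(1)[OF V \<xi>] IJ(2) simple_integral(1)[OF W \<eta>]
        simple_integral(2)[OF V \<xi>] simple_integral(2)[OF W \<eta>] I J])
  have right: "(\<lambda>k. \<integral>x. (\<lambda>(\<omega>, s). simple_value (n k) (t k) (\<xi> k) s \<omega>) x
      * (\<lambda>(\<omega>, s). simple_value (m k) (u k) (\<eta> k) s \<omega>) x \<partial>(M \<Otimes>\<^sub>M lborel))
    \<longlonglongrightarrow> (\<integral>x. cut_integrand T H x * cut_integrand T K x \<partial>(M \<Otimes>\<^sub>M lborel))"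
    by (rule tendsto_mean_square_inner[OF H simple_value_measurable(1)[OF \<xi>] K simple_value_measurable(1)[OF \<eta>]
        simple_value_measurable(2)[OF \<xi>] simple_value_measurable(2)[OF \<eta>] H_lim K_lim])
  show ?thesis
    using left tendsto_mult_left[OF right, of \<rho>]
    unfolding expectation_simple_integral_product[OF cov \<xi> \<eta>] integral_simple_value_product[OF \<xi> \<eta>]
    by (rule LIMSEQ_unique)
qed

end

text \<open>Path continuity upgrades measurability at each fixed time to joint measurability: the
  process is the pointwise limit of its values at the grid point at or below \<open>s\<close>, and
  each grid is countable. \<open>max 0\<close> keeps the time in the range where \<open>S\<close> is
  controlled.\<close>

lemma borel_measurable_continuous_process:
  fixes S :: "real \<Rightarrow> 'a \<Rightarrow> real"
  assumes meas: "\<And>t. 0 \<le> t \<Longrightarrow> S t \<in> borel_measurable M"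
    and cont: "\<And>\<omega>. \<omega> \<in> space M \<Longrightarrow> continuous_on {0..} (\<lambda>t. S t \<omega>)"
  shows "(\<lambda>(\<omega>, s). S (max 0 s) \<omega>) \<in> borel_measurable (M \<Otimes>\<^sub>M lborel)"
proof (rule borel_measurable_LIMSEQ_real)
  define grid where "grid n s = \<lfloor>s * real (Suc n)\<rfloor>" for n s
  define q where "q n j = max 0 (real_of_int j / real (Suc n))" for n j
  show "(\<lambda>x. S (q n (grid n (snd x))) (fst x)) \<in> borel_measurable (M \<Otimes>\<^sub>M lborel)" for n
  proof (rule measurable_compose_countable)
    fix j
    have [measurable]: "S (q n j) \<in> borel_measurable M"
      by (rule meas) (simp add: q_def)
    show "(\<lambda>x. S (q n j) (fst x)) \<in> borel_measurable (M \<Otimes>\<^sub>M lborel)"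
      by measurable
    show "(\<lambda>x. grid n (snd x)) \<in> measurable (M \<Otimes>\<^sub>M lborel) (count_space UNIV)"
      unfolding grid_def by measurable
  qed
  fix x assume "x \<in> space (M \<Otimes>\<^sub>M (lborel :: real measure))"
  then obtain \<omega> s where x: "x = (\<omega>, s)" "\<omega> \<in> space M"
    by (auto simp: space_pair_measure)
  have "(\<lambda>n. real_of_int (grid n s) / real (Suc n)) \<longlonglongrightarrow> s"
  proof (rule tendsto_sandwich[OF _ _ _ tendsto_const])
    have *: "s * real (Suc n) - 1 \<le> real_of_int (grid n s)" "real_of_int (grid n s) \<le> s * real (Suc n)" for n
      unfolding grid_def by linarith+
    show "\<forall>\<^sub>F n in sequentially. s - 1 / real (Suc n) \<le> real_of_int (grid n s) / real (Suc n)"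
      using *(1) by (intro always_eventually allI)
        (simp add: pos_le_divide_eq left_diff_distrib del: of_nat_Suc)
    show "\<forall>\<^sub>F n in sequentially. real_of_int (grid n s) / real (Suc n) \<le> s"
      using *(2) by (intro always_eventually allI) (simp add: pos_divide_le_eq del: of_nat_Suc)
    have "(\<lambda>n. s - 1 / real (Suc n)) \<longlonglongrightarrow> s - 0"
      by (intro tendsto_diff tendsto_const LIMSEQ_Suc[OF lim_1_over_n])
    then show "(\<lambda>n. s - 1 / real (Suc n)) \<longlonglongrightarrow> s"
      by simp
  qed
  then have "(\<lambda>n. q n (grid n s)) \<longlonglongrightarrow> max 0 s"
    unfolding q_def by (intro tendsto_max tendsto_const)
  then have "(\<lambda>n. S (q n (grid n s)) \<omega>) \<longlonglongrightarrow> S (max 0 s) \<omega>"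
    by (rule continuous_on_tendsto_compose[OF cont[OF x(2)]]) (auto simp: q_def)
  then show "(\<lambda>n. S (q n (grid n (snd x))) (fst x)) \<longlonglongrightarrow> (case x of (\<omega>, s) \<Rightarrow> S (max 0 s) \<omega>)"
    by (simp add: x)
qed

text \<open>A bootstrap from integrability alone: the equation makes \<open>m\<close> continuous,
  being affine in an indefinite integral, hence differentiable, and then
  \<open>exp (- \<kappa> * u)\<close> is an integrating factor.\<close>

lemma linear_integral_equation:
  fixes m :: "real \<Rightarrow> real"
  assumes int: "\<And>t. 0 \<le> t \<Longrightarrow> set_integrable lborel {0..t} m"
    and eq: "\<And>t. 0 \<le> t \<Longrightarrow> m t = c + \<kappa> * (\<integral>s\<in>{0..t}. m s \<partial>lborel)"
    and t: "0 \<le> t"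
  shows "m t = c * exp (\<kappa> * t)"
proof -
  have hk: "m integrable_on {0..u}" "(\<integral>s\<in>{0..u}. m s \<partial>lborel) = integral {0..u} m" if "0 \<le> u" for u
    using set_borel_integral_eq_integral[OF int[OF that]] by auto
  have m: "m u = c + \<kappa> * integral {0..u} m" if "u \<in> {0..t}" for u
    using eq[of u] hk[of u] that by simp
  have "continuous_on {0..t} (\<lambda>u. c + \<kappa> * integral {0..u} m)"
    using hk(1)[OF t] by (intro continuous_intros indefinite_integral_continuous_1)
  then have cont: "continuous_on {0..t} m"
    by (rule continuous_on_eq) (rule m[symmetric])
  have "((\<lambda>u. m u * exp (- \<kappa> * u)) has_real_derivative 0) (at u within {0..t})" if u: "u \<in> {0..t}" for u
  proof -
    have "((\<lambda>u. c + \<kappa> * integral {0..u} m) has_real_derivative \<kappa> * m u) (at u within {0..t})"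
      using integral_has_real_derivative[OF cont u] by (auto intro!: derivative_eq_intros)
    then have d: "(m has_real_derivative \<kappa> * m u) (at u within {0..t})"
      by (rule has_field_derivative_transform_within[OF _ zero_less_one u]) (simp add: m)
    show ?thesis
      by (rule derivative_eq_intros d refl | simp add: algebra_simps)+
  qed
  then obtain k where k: "\<And>u. u \<in> {0..t} \<Longrightarrow> m u * exp (- \<kappa> * u) = k"
    using has_field_derivative_zero_constant[of "{0..t}" "\<lambda>u. m u * exp (- \<kappa> * u)"] by auto
  have "m 0 = c"
    using m[of 0] t by simp
  then have "m t * exp (- \<kappa> * t) = c"
    using k[of t] k[of 0] t by simp
  then show ?thesis
    by (simp add: exp_minus field_simps)
qed

section \<open>Moments of the driftless prices\<close>

context filtered_prob_space
begin

lemma driftless_price_measurable: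
  assumes "driftless_price_process M F W \<sigma> S"
  shows "cut_integrand T (\<lambda>s \<omega>. \<sigma> * S s \<omega>) \<in> borel_measurable (M \<Otimes>\<^sub>M lborel)"
proof -
  have "S t \<in> borel_measurable M" if "0 \<le> t" for t
    using assms that by (intro measurable_F_imp_M[of _ t]) (simp add: driftless_price_process_def adapted_process_def)
  then have *: "(\<lambda>(\<omega>, s). S (max 0 s) \<omega>) \<in> borel_measurable (M \<Otimes>\<^sub>M lborel)"
    using assms by (intro borel_measurable_continuous_process) (simp_all add: driftless_price_process_def)
  have "cut_integrand T (\<lambda>s \<omega>. \<sigma> * S s \<omega>)
      = (\<lambda>x. indicator {0..T} (snd x) * (\<sigma> * (\<lambda>(\<omega>, s). S (max 0 s) \<omega>) x))"
    by (auto simp: cut_integrand_def fun_eq_iff indicator_def)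
  then show "cut_integrand T (\<lambda>s \<omega>. \<sigma> * S s \<omega>) \<in> borel_measurable (M \<Otimes>\<^sub>M lborel)"
    using * by simp
qed

text \<open>The price equation asserts no moments, but an Ito integral is a mean-square limit of
  centred variables, so the price is almost surely a constant plus a centred square integrable
  variable.\<close>

lemma driftless_price_first_moment:
  assumes bm: "brownian_motion_wrt M F W" and S: "driftless_price_process M F W \<sigma> S"
    and c: "\<And>\<omega>. \<omega> \<in> space M \<Longrightarrow> S 0 \<omega> = c" and t: "0 \<le> t"
  shows "S t \<in> borel_measurable M" and "integrable M (\<lambda>\<omega>. (S t \<omega>)\<^sup>2)"
    and "integrable M (S t)" and "expectation (S t) = c"
proof -
  obtain I where I: "has_ito_integral M F W (\<lambda>s \<omega>. \<sigma> * S s \<omega>) t I" "AE \<omega> in M. S t \<omega> = S 0 \<omega> + I \<omega>"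
    using S t unfolding driftless_price_process_def by blast
  note ito = ito_integral_square_integrable[OF bm I(1) driftless_price_measurable[OF S]]
  have [measurable]: "I \<in> borel_measurable M"
    by (rule ito(1))
  show [measurable]: "S t \<in> borel_measurable M"
    using S t by (intro measurable_F_imp_M[of _ t]) (simp add: driftless_price_process_def adapted_process_def)
  have eq: "AE \<omega> in M. S t \<omega> = c + I \<omega>"
    using I(2) AE_space by eventually_elim (simp add: c)
  have int: "integrable M I"
    using ito(1,2) by (rule square_integrable_imp_integrable)
  have "integrable M (\<lambda>\<omega>. (c + I \<omega>)\<^sup>2)"
    using ito(2) by (intro integrable_square_add) simp_all
  then show "integrable M (\<lambda>\<omega>. (S t \<omega>)\<^sup>2)"
    by (rule integrable_cong_AE_imp) (use eq in \<open>auto elim: eventually_mono\<close>)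
  have "integrable M (\<lambda>\<omega>. c + I \<omega>)"
    using int by simp
  then show "integrable M (S t)"
    by (rule integrable_cong_AE_imp) (use eq in \<open>auto elim: eventually_mono\<close>)
  have "expectation (S t) = expectation (\<lambda>\<omega>. c + I \<omega>)"
    using eq by (intro integral_cong_AE) simp_all
  also have "\<dots> = c"
    using int ito(3) by (simp add: prob_space)
  finally show "expectation (S t) = c" .
qed

lemma driftless_price_product_moment:
  assumes cov: "covariation \<rho> V W"
    and R: "driftless_price_process M F V \<sigma>\<^sub>1 R" and S: "driftless_price_process M F W \<sigma>\<^sub>2 S"
    and c: "\<And>\<omega>. \<omega> \<in> space M \<Longrightarrow> R 0 \<omega> = c" and d: "\<And>\<omega>. \<omega> \<in> space M \<Longrightarrow> S 0 \<omega> = d"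
    and nz: "\<sigma>\<^sub>1 \<noteq> 0" "\<sigma>\<^sub>2 \<noteq> 0" and t: "0 \<le> t"
  shows "expectation (\<lambda>\<omega>. R t \<omega> * S t \<omega>) = c * d * exp (\<rho> * \<sigma>\<^sub>1 * \<sigma>\<^sub>2 * t)"
proof -
  have V: "brownian_motion_wrt M F V" and W: "brownian_motion_wrt M F W"
    using cov by (simp_all add: covariation_def)
  define m where "m u = expectation (\<lambda>\<omega>. R u \<omega> * S u \<omega>)" for u
  have main: "set_integrable lborel {0..u} m
      \<and> m u = c * d + (\<rho> * \<sigma>\<^sub>1 * \<sigma>\<^sub>2) * (\<integral>s\<in>{0..u}. m s \<partial>lborel)" if u: "0 \<le> u" for u
  proof -
    obtain I where I: "has_ito_integral M F V (\<lambda>s \<omega>. \<sigma>\<^sub>1 * R s \<omega>) u I" "AE \<omega> in M. R u \<omega> = R 0 \<omega> + I \<omega>"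
      using R u unfolding driftless_price_process_def by blast
    obtain J where J: "has_ito_integral M F W (\<lambda>s \<omega>. \<sigma>\<^sub>2 * S s \<omega>) u J" "AE \<omega> in M. S u \<omega> = S 0 \<omega> + J \<omega>"
      using S u unfolding driftless_price_process_def by blast
    let ?H = "cut_integrand u (\<lambda>s \<omega>. \<sigma>\<^sub>1 * R s \<omega>)" and ?K = "cut_integrand u (\<lambda>s \<omega>. \<sigma>\<^sub>2 * S s \<omega>)"
    note H = driftless_price_measurable[OF R, of u] and K = driftless_price_measurable[OF S, of u]
    note itoI = ito_integral_square_integrable[OF V I(1) H]
    note itoJ = ito_integral_square_integrable[OF W J(1) K]
    note [measurable] = itoI(1) itoJ(1) driftless_price_first_moment(1)[OF V R c u]
      driftless_price_first_moment(1)[OF W S d u]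
    have IJ: "integrable M I" "integrable M J" "integrable M (\<lambda>\<omega>. I \<omega> * J \<omega>)"
      using itoI(1,2) itoJ(1,2)
      by (auto intro: square_integrable_imp_integrable integrable_mult_square_integrable)
    define f where "f \<omega> s = indicator {0..u} s * (R s \<omega> * S s \<omega>)" for \<omega> s
    have HK: "?H x * ?K x = \<sigma>\<^sub>1 * \<sigma>\<^sub>2 * case_prod f x" for x
      by (simp add: cut_integrand_def f_def case_prod_beta' indicator_def)
    have "integrable (M \<Otimes>\<^sub>M lborel) (\<lambda>x. ?H x * ?K x)"
      by (rule integrable_mult_square_integrable[OF H K itoI(4) itoJ(4)])
    then have "integrable (M \<Otimes>\<^sub>M lborel) (\<lambda>x. \<sigma>\<^sub>1 * \<sigma>\<^sub>2 * case_prod f x)"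
      by (simp only: HK)
    \<comment> \<open>Nonzero volatilities enter here: the Ito integrals control only the volatility
      times the price, and \<open>\<sigma>\<^sub>1 * \<sigma>\<^sub>2\<close> has to be divided
      out.\<close>
    then have f: "integrable (M \<Otimes>\<^sub>M lborel) (case_prod f)"
      using nz by simp
    have inner: "expectation (\<lambda>\<omega>. f \<omega> s) = indicator {0..u} s *\<^sub>R m s" for s
      by (simp add: f_def m_def)
    have "expectation (\<lambda>\<omega>. I \<omega> * J \<omega>) = \<rho> * (\<integral>x. ?H x * ?K x \<partial>(M \<Otimes>\<^sub>M lborel))"
      by (rule ito_isometry[OF cov I(1) J(1) H K])
    also have "(\<integral>x. ?H x * ?K x \<partial>(M \<Otimes>\<^sub>M lborel)) = \<sigma>\<^sub>1 * \<sigma>\<^sub>2 * integral\<^sup>L (M \<Otimes>\<^sub>M lborel) (case_prod f)"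
      unfolding HK by simp
    \<comment> \<open>Fubini takes the expectation first, so the integrand in time is again the
      product moment; this closes the equation for \<open>m\<close>.\<close>
    also have "integral\<^sup>L (M \<Otimes>\<^sub>M lborel) (case_prod f) = (\<integral>s\<in>{0..u}. m s \<partial>lborel)"
      using M_lborel.integral_snd[OF f] by (simp only: inner set_lebesgue_integral_def)
    finally have EIJ: "expectation (\<lambda>\<omega>. I \<omega> * J \<omega>) = (\<rho> * \<sigma>\<^sub>1 * \<sigma>\<^sub>2) * (\<integral>s\<in>{0..u}. m s \<partial>lborel)"
      by (simp only: mult.assoc)
    \<comment> \<open>In the expansion the terms with a single Ito integral have mean 0, leaving the
      initial product and the covariance of the integrals.\<close>
    have "AE \<omega> in M. R u \<omega> * S u \<omega> = c * d + c * J \<omega> + d * I \<omega> + I \<omega> * J \<omega>"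
      using I(2) J(2) AE_space by eventually_elim (simp add: c d algebra_simps)
    then have "m u = expectation (\<lambda>\<omega>. c * d + c * J \<omega> + d * I \<omega> + I \<omega> * J \<omega>)"
      unfolding m_def by (intro integral_cong_AE) simp_all
    also have "\<dots> = c * d + expectation (\<lambda>\<omega>. I \<omega> * J \<omega>)"
      using IJ itoI(3) itoJ(3) by (simp add: prob_space)
    finally show ?thesis
      using EIJ M_lborel.integrable_snd[OF f] by (simp add: inner set_integrable_def)
  qed
  have "m t = c * d * exp ((\<rho> * \<sigma>\<^sub>1 * \<sigma>\<^sub>2) * t)"
    by (rule linear_integral_equation[OF _ _ t]) (use main in blast)+
  then show ?thesis
    by (simp add: m_def)
qed

lemma relative_price_sum_moments:
  assumes corr: "correlated_brownian_motions M F \<rho> WA WB"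
    and SA: "driftless_price_process M F WA \<sigma>A SA" and SB: "driftless_price_process M F WB \<sigma>B SB"
    and nz: "\<sigma>A \<noteq> 0" "\<sigma>B \<noteq> 0" and t: "0 \<le> t"
  shows "expectation (relative_price_sum SA SB t) = 2"
    and "expectation (\<lambda>\<omega>. (relative_price_sum SA SB t \<omega>)\<^sup>2)
      = exp (\<sigma>A\<^sup>2 * t) + exp (\<sigma>B\<^sup>2 * t) + 2 * exp (\<rho> * \<sigma>A * \<sigma>B * t)"
proof -
  obtain a where a: "0 < a" "\<And>\<omega>. \<omega> \<in> space M \<Longrightarrow> SA 0 \<omega> = a"
    using SA unfolding driftless_price_process_def by blast
  obtain b where b: "0 < b" "\<And>\<omega>. \<omega> \<in> space M \<Longrightarrow> SB 0 \<omega> = b"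
    using SB unfolding driftless_price_process_def by blast
  have A: "brownian_motion_wrt M F WA" and B: "brownian_motion_wrt M F WB"
    using corr by (simp_all add: correlated_brownian_motions_def)
  note mA = driftless_price_first_moment[OF A SA a(2) t]
  note mB = driftless_price_first_moment[OF B SB b(2) t]
  have AA: "expectation (\<lambda>\<omega>. SA t \<omega> * SA t \<omega>) = a * a * exp (1 * \<sigma>A * \<sigma>A * t)"
    by (rule driftless_price_product_moment[OF covariation_self[OF A] SA SA a(2) a(2) nz(1) nz(1) t])
  have BB: "expectation (\<lambda>\<omega>. SB t \<omega> * SB t \<omega>) = b * b * exp (1 * \<sigma>B * \<sigma>B * t)"
    by (rule driftless_price_product_moment[OF covariation_self[OF B] SB SB b(2) b(2) nz(2) nz(2) t])
  have AB: "expectation (\<lambda>\<omega>. SA t \<omega> * SB t \<omega>) = a * b * exp (\<rho> * \<sigma>A * \<sigma>B * t)"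
    by (rule driftless_price_product_moment[OF covariation_correlated[OF corr] SA SB a(2) b(2) nz t])
  have int: "integrable M (\<lambda>\<omega>. SA t \<omega> * SA t \<omega>)" "integrable M (\<lambda>\<omega>. SB t \<omega> * SB t \<omega>)"
    "integrable M (\<lambda>\<omega>. SA t \<omega> * SB t \<omega>)"
    using mA(1,2) mB(1,2) by (auto intro!: integrable_mult_square_integrable)
  have Z: "relative_price_sum SA SB t \<omega> = SA t \<omega> / a + SB t \<omega> / b" if "\<omega> \<in> space M" for \<omega>
    using that by (simp add: relative_price_sum_def a(2) b(2))
  have "expectation (relative_price_sum SA SB t) = expectation (\<lambda>\<omega>. SA t \<omega> / a + SB t \<omega> / b)"
    by (rule Bochner_Integration.integral_cong[OF refl Z])
  also have "\<dots> = 2"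
    using mA(3,4) mB(3,4) a(1) b(1) by simp
  finally show "expectation (relative_price_sum SA SB t) = 2" .
  have "expectation (\<lambda>\<omega>. (relative_price_sum SA SB t \<omega>)\<^sup>2)
    = expectation (\<lambda>\<omega>. (SA t \<omega> * SA t \<omega>) / (a * a) + (SB t \<omega> * SB t \<omega>) / (b * b)
        + 2 * (SA t \<omega> * SB t \<omega>) / (a * b))"
    using a(1) b(1) by (intro Bochner_Integration.integral_cong refl)
      (simp add: Z power2_sum, simp add: power2_eq_square)
  also have "\<dots> = a * a * exp (1 * \<sigma>A * \<sigma>A * t) / (a * a) + b * b * exp (1 * \<sigma>B * \<sigma>B * t) / (b * b)
      + 2 * (a * b * exp (\<rho> * \<sigma>A * \<sigma>B * t)) / (a * b)"
    unfolding AA[symmetric] BB[symmetric] AB[symmetric] using int by simp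
  also have "\<dots> = exp (\<sigma>A\<^sup>2 * t) + exp (\<sigma>B\<^sup>2 * t) + 2 * exp (\<rho> * \<sigma>A * \<sigma>B * t)"
    using a(1) b(1) by (simp add: power2_eq_square)
  finally show "expectation (\<lambda>\<omega>. (relative_price_sum SA SB t \<omega>)\<^sup>2)
      = exp (\<sigma>A\<^sup>2 * t) + exp (\<sigma>B\<^sup>2 * t) + 2 * exp (\<rho> * \<sigma>A * \<sigma>B * t)" .
qed

end

section \<open>Normal tails and the crossing probability\<close>

text \<open>Completing the square: an exponential weight moves the mean by
  \<open>c * s\<^sup>2\<close> and keeps the variance, which is Girsanov's theorem for a single
  normal variable.\<close>

lemma normal_density_exp_tilt:
  assumes "0 < s"
  shows "normal_density m s x * exp (c * x)
    = exp (c * m + c\<^sup>2 * s\<^sup>2 / 2) * normal_density (m + c * s\<^sup>2) s x"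
proof -
  have "c * x - (x - m)\<^sup>2 / (2 * s\<^sup>2)
      = c * m + c\<^sup>2 * s\<^sup>2 / 2 - (x - (m + c * s\<^sup>2))\<^sup>2 / (2 * s\<^sup>2)"
    using assms by (simp add: field_simps power2_eq_square)
  then have "exp (c * x) * exp (- ((x - m)\<^sup>2 / (2 * s\<^sup>2)))
      = exp (c * m + c\<^sup>2 * s\<^sup>2 / 2) * exp (- ((x - (m + c * s\<^sup>2))\<^sup>2 / (2 * s\<^sup>2)))"
    by (simp add: exp_add[symmetric] algebra_simps)
  then show ?thesis
    by (simp add: normal_density_def mult_ac)
qed

lemma (in prob_space) normal_distributed_exp:
  assumes "0 < s" and D: "distributed M lborel X (normal_density m s)"
  shows "integrable M (\<lambda>\<omega>. exp (c * X \<omega>))"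
    and "expectation (\<lambda>\<omega>. exp (c * X \<omega>)) = exp (c * m + c\<^sup>2 * s\<^sup>2 / 2)"
proof -
  have "integrable lborel (\<lambda>x. normal_density m s x * exp (c * x))"
    using assms(1) by (simp add: normal_density_exp_tilt)
  then show "integrable M (\<lambda>\<omega>. exp (c * X \<omega>))"
    by (subst (asm) distributed_integrable[OF D]) simp_all
  show "expectation (\<lambda>\<omega>. exp (c * X \<omega>)) = exp (c * m + c\<^sup>2 * s\<^sup>2 / 2)"
    using assms(1)
    by (subst distributed_integral[OF D, symmetric]) (simp_all add: normal_density_exp_tilt)
qed

lemma std_normal_cdf_eq_integral:
  "\<Phi> u = (\<integral>y. std_normal_density y * indicator {..u} y \<partial>lborel)"
proof -
  interpret real_distribution std_normal_distribution by (rule real_dist_normal_dist)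
  have "\<Phi> u = (\<integral>y. indicator {..u} y \<partial>std_normal_distribution)"
    by (simp add: cdf_def)
  also have "\<dots> = (\<integral>y. std_normal_density y * indicator {..u} y \<partial>lborel)"
    by (subst integral_density) simp_all
  finally show ?thesis .
qed

text \<open>The substitution \<open>x = m - s * y\<close> reverses orientation, which turns an upper
  tail directly into a value of \<Phi>.\<close>

lemma normal_density_upper_tail:
  assumes "0 < s"
  shows "(\<integral>x. normal_density m s x * indicator {a..} x \<partial>lborel) = \<Phi> ((m - a) / s)"
proof -
  have "(\<integral>x. normal_density m s x * indicator {a..} x \<partial>lborel)
      = \<bar>- s\<bar> *\<^sub>R (\<integral>y. normal_density m s (m + (- s) * y) * indicator {a..} (m + (- s) * y) \<partial>lborel)"
    using assms by (intro lborel_integral_real_affine) simp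
  also have "\<dots> = (\<integral>y. s * (normal_density m s (m + (- s) * y) * indicator {a..} (m + (- s) * y)) \<partial>lborel)"
    using assms by simp
  also have "\<dots> = (\<integral>y. std_normal_density y * indicator {..(m - a) / s} y \<partial>lborel)"
  proof (intro Bochner_Integration.integral_cong refl)
    fix y
    have "s * normal_density m s (m + (- s) * y) = std_normal_density y"
      using assms by (simp add: normal_density_def real_sqrt_mult power_mult_distrib)
    moreover have "a \<le> m + (- s) * y \<longleftrightarrow> y \<le> (m - a) / s"
      using assms by (simp add: field_simps)
    ultimately show "s * (normal_density m s (m + (- s) * y) * indicator {a..} (m + (- s) * y))
        = std_normal_density y * indicator {..(m - a) / s} y"
      by (simp add: indicator_def)
  qed
  finally show ?thesis
    by (simp add: std_normal_cdf_eq_integral)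
qed

lemma isCont_std_normal_cdf: "isCont \<Phi> x"
proof -
  interpret real_distribution std_normal_distribution by (rule real_dist_normal_dist)
  have "emeasure std_normal_distribution {x} = 0"
    by (subst emeasure_density) simp_all
  then show ?thesis
    by (simp add: isCont_cdf measure_def)
qed

text \<open>The upper tail formula with mean 0 and deviation 1 identifies
  \<open>\<Phi> (- u)\<close> as the mass of \<open>{u..}\<close>; this half-line and
  \<open>{..u}\<close> share only a null set.\<close>

lemma std_normal_cdf_uminus: "\<Phi> (- u) = 1 - \<Phi> u"
proof -
  have int: "integrable lborel (\<lambda>y. std_normal_density y * indicator A y)" if "A \<in> sets borel" for A :: "real set"
    using integrable_mult_indicator[OF _ integrable_normal_density[of 1 0], of A] that
    by (simp add: mult.commute)
  have "\<Phi> u + \<Phi> (- u) = (\<integral>y. std_normal_density y * indicator {..u} y \<partial>lborel)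
      + (\<integral>y. std_normal_density y * indicator {u..} y \<partial>lborel)"
    using normal_density_upper_tail[of 1 0 u] by (simp add: std_normal_cdf_eq_integral)
  also have "\<dots> = (\<integral>y. std_normal_density y * indicator {..u} y + std_normal_density y * indicator {u..} y \<partial>lborel)"
    by (rule Bochner_Integration.integral_add[symmetric]) (auto intro!: int)
  also have "\<dots> = (\<integral>y. std_normal_density y \<partial>lborel)"
    using AE_lborel_singleton[of u]
    by (intro integral_cong_AE) (auto simp: indicator_def elim!: eventually_mono)
  also have "\<dots> = 1"
    by simp
  finally show ?thesis by simp
qed

text \<open>
  The expectation of \<open>reflection_payoff (X\<^sub>T - b)\<close> is the crossing probability of the level \<open>b\<close>
  because a path started at the level has expected payoff 1 whatever the remaining time.
\<close>

definition reflection_payoff :: "real \<Rightarrow> real" where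
  "reflection_payoff z = (if 0 \<le> z then 1 + exp z else 0)"

lemma reflection_payoff_nonneg: "0 \<le> reflection_payoff z"
  by (simp add: reflection_payoff_def add_nonneg_nonneg)

lemma mono_reflection_payoff: "mono reflection_payoff"
  by (rule monoI) (auto simp: reflection_payoff_def add_nonneg_nonneg)

lemma borel_measurable_reflection_payoff [measurable]:
  "reflection_payoff \<in> borel_measurable borel"
  unfolding reflection_payoff_def by measurable

text \<open>\<open>s\<close> stands for the standard deviation \<open>\<sigma> * sqrt T\<close> of
  the log-price at the horizon, whose mean is then \<open>- s\<^sup>2 / 2\<close>. For
  \<open>a \<ge> 0\<close> this is the classical probability that the maximum of Brownian motion
  with drift reaches \<open>a\<close>.\<close>

definition crossing_prob :: "real \<Rightarrow> real \<Rightarrow> real" where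
  "crossing_prob s a = \<Phi> ((- a - s\<^sup>2 / 2) / s) + exp (- a) * \<Phi> ((- a + s\<^sup>2 / 2) / s)"

lemma isCont_crossing_prob:
  assumes "s > 0"
  shows "isCont (crossing_prob s) a"
proof -
  have \<Phi>: "isCont (\<lambda>a. \<Phi> (g a)) a" if "isCont g a" for g :: "real \<Rightarrow> real"
    by (rule isCont_o2[OF that isCont_std_normal_cdf])
  have "isCont (\<lambda>a. (- a - s\<^sup>2 / 2) / s) a" "isCont (\<lambda>a. (- a + s\<^sup>2 / 2) / s) a"
    "isCont (\<lambda>a. exp (- a)) a"
    using assms by (auto intro!: continuous_intros)
  then show ?thesis
    unfolding crossing_prob_def[abs_def]
    by (intro isCont_add isCont_mult \<Phi>)
qed

text \<open>At level 0 the two arguments of \<Phi> are opposite for every \<open>s\<close>.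
  Independence of \<open>s\<close>, hence of the remaining time, makes the payoff usable at a random
  hitting time.\<close>

lemma crossing_prob_0: "crossing_prob s 0 = 1"
proof -
  have "(- 0 - s\<^sup>2 / 2) / s = - ((- 0 + s\<^sup>2 / 2) / s)"
    \<comment> \<open>At \<open>s = 0\<close> both quotients are 0, division by zero being
      0.\<close>
    by (cases "s = 0") (simp_all add: field_simps)
  then have "\<Phi> ((- 0 - s\<^sup>2 / 2) / s) = 1 - \<Phi> ((- 0 + s\<^sup>2 / 2) / s)"
    by (simp only: std_normal_cdf_uminus)
  then show ?thesis
    by (simp only: crossing_prob_def minus_zero exp_zero)
qed

text \<open>The constant part of the payoff gives an upper tail, the exponential part the upper tail
  of the tilted law weighted by \<open>exp (- a)\<close>; these are the two terms of
  \<open>crossing_prob\<close>.\<close>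

lemma (in prob_space) reflection_payoff_normal:
  assumes s: "0 < s" and D: "distributed M lborel X (normal_density (- s\<^sup>2 / 2) s)"
  shows "integrable M (\<lambda>\<omega>. reflection_payoff (X \<omega> - a))"
    and "expectation (\<lambda>\<omega>. reflection_payoff (X \<omega> - a)) = crossing_prob s a"
proof -
  let ?m = "- s\<^sup>2 / 2"
  have int: "integrable lborel (\<lambda>x. normal_density m s x * indicator {a..} x)" for m
    using integrable_mult_indicator[OF _ integrable_normal_density[OF s, of m], of "{a..}"]
    by (simp add: mult.commute)
  \<comment> \<open>With \<open>c = 1\<close> the normalising factor is 1 exactly because the mean
    is \<open>- s\<^sup>2 / 2\<close>; the tilt flips the sign of the mean.\<close>
  have tilt: "normal_density ?m s x * exp x = normal_density (s\<^sup>2 / 2) s x" for x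
    using normal_density_exp_tilt[OF s, of ?m x 1] by simp
  have eq: "normal_density ?m s x * reflection_payoff (x - a)
      = normal_density ?m s x * indicator {a..} x
        + exp (- a) * (normal_density (s\<^sup>2 / 2) s x * indicator {a..} x)" for x
    unfolding tilt[symmetric]
    by (simp add: reflection_payoff_def indicator_def exp_diff exp_minus field_simps)
  have "integrable lborel (\<lambda>x. normal_density ?m s x * reflection_payoff (x - a))"
    unfolding eq by (intro Bochner_Integration.integrable_add integrable_mult_right int)
  then show "integrable M (\<lambda>\<omega>. reflection_payoff (X \<omega> - a))"
    by (subst (asm) distributed_integrable[OF D]) simp_all
  have "expectation (\<lambda>\<omega>. reflection_payoff (X \<omega> - a))
      = (\<integral>x. normal_density ?m s x * reflection_payoff (x - a) \<partial>lborel)"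
    by (subst distributed_integral[OF D, symmetric]) simp_all
  also have "\<dots> = \<Phi> ((?m - a) / s) + exp (- a) * \<Phi> ((s\<^sup>2 / 2 - a) / s)"
    unfolding eq
    by (subst Bochner_Integration.integral_add)
      (auto intro!: int integrable_mult_right simp: normal_density_upper_tail[OF s])
  also have "\<dots> = crossing_prob s a"
  proof -
    have "?m - a = - a - s\<^sup>2 / 2" "s\<^sup>2 / 2 - a = - a + s\<^sup>2 / 2"
      by simp_all
    then show ?thesis
      by (simp only: crossing_prob_def)
  qed
  finally show "expectation (\<lambda>\<omega>. reflection_payoff (X \<omega> - a)) = crossing_prob s a" .
qed

text \<open>At most one index is a first hit, so the sum has at most one nonzero term. It serves
  twice, with \<open>g\<close> the payoff and with \<open>g\<close> constantly 1, which sums the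
  first-hit indicators.\<close>

lemma sum_first_hit:
  fixes x :: "nat \<Rightarrow> real" and g :: "nat \<Rightarrow> real"
  shows "(\<Sum>k<n. if (\<forall>j<k. x j < b) \<and> b \<le> x k then g k else 0)
    = (if \<exists>k<n. b \<le> x k then g (LEAST k. b \<le> x k) else 0)"
proof (cases "\<exists>k<n. b \<le> x k")
  case True
  then obtain k0 where k0: "k0 < n" "b \<le> x k0" by auto
  define k where "k = (LEAST k. b \<le> x k)"
  have k: "b \<le> x k" "k \<le> k0"
    unfolding k_def using k0 by (auto intro: LeastI Least_le)
  have first: "(\<forall>j<i. x j < b) \<and> b \<le> x i \<longleftrightarrow> i = k" for i
  proof
    assume i: "(\<forall>j<i. x j < b) \<and> b \<le> x i"
    show "i = k"
      using i k(1) not_less_Least[of i "\<lambda>k. b \<le> x k"] k_def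
      by (metis linorder_cases not_less)
  next
    assume "i = k"
    then show "(\<forall>j<i. x j < b) \<and> b \<le> x i"
      using k(1) not_less_Least[of _ "\<lambda>k. b \<le> x k"] k_def by (metis not_less)
  qed
  show ?thesis
    unfolding first using True k(2) k0(1) by (simp add: k_def[symmetric])
qed (auto intro!: sum.neutral)

section \<open>Stopping the log-price on a finite time grid\<close>

locale driftless_gbm = prob_space M for M :: "'a measure" +
  fixes W :: "real \<Rightarrow> 'a \<Rightarrow> real" and \<sigma> :: real
  assumes bm: "brownian_motion M W" and vol_pos: "0 < \<sigma>"
begin

text \<open>Subtracting \<open>W 0\<close>, which vanishes only almost surely, makes every path start at 0.\<close>

definition log_price :: "real \<Rightarrow> 'a \<Rightarrow> real" where
  "log_price t \<omega> = \<sigma> * (W t \<omega> - W 0 \<omega>) - \<sigma>\<^sup>2 / 2 * t"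

lemma log_price_0 [simp]: "log_price 0 \<omega> = 0"
  by (simp add: log_price_def)

lemma borel_measurable_W: "0 \<le> t \<Longrightarrow> W t \<in> borel_measurable M"
  using bm by (simp add: brownian_motion_def)

lemma borel_measurable_log_price: "0 \<le> t \<Longrightarrow> log_price t \<in> borel_measurable M"
  using borel_measurable_W[of t] borel_measurable_W[of 0] unfolding log_price_def by measurable

lemma continuous_on_log_price:
  assumes "\<omega> \<in> space M"
  shows "continuous_on {0..} (\<lambda>t. log_price t \<omega>)"
proof -
  have "continuous_on {0..} (\<lambda>t. W t \<omega>)"
    using bm assms by (simp add: brownian_motion_def)
  then show ?thesis
    unfolding log_price_def by (intro continuous_intros)
qed

lemma distributed_log_price_increment:
  assumes "0 \<le> s" "s < t"
  defines "v \<equiv> \<sigma> * sqrt (t - s)"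
  shows "distributed M lborel (\<lambda>\<omega>. log_price t \<omega> - log_price s \<omega>) (normal_density (- v\<^sup>2 / 2) v)"
proof -
  have D: "distributed M lborel (\<lambda>\<omega>. W t \<omega> - W s \<omega>) (normal_density 0 (sqrt (t - s)))"
    using bm assms(1,2) by (simp add: brownian_motion_def)
  have "distributed M lborel (\<lambda>\<omega>. - v\<^sup>2 / 2 + \<sigma> * (W t \<omega> - W s \<omega>))
      (normal_density (- v\<^sup>2 / 2 + \<sigma> * 0) (\<bar>\<sigma>\<bar> * sqrt (t - s)))"
    using assms(2) vol_pos by (intro normal_density_affine[OF D]) auto
  moreover have "- v\<^sup>2 / 2 + \<sigma> * (W t \<omega> - W s \<omega>) = log_price t \<omega> - log_price s \<omega>" for \<omega>
    using assms(2) by (simp add: log_price_def v_def power_mult_distrib field_simps)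
  ultimately show ?thesis
    using vol_pos by (simp add: v_def)
qed

lemma reflection_payoff_increment:
  assumes "0 \<le> s" "s < t"
  shows "integrable M (\<lambda>\<omega>. reflection_payoff (log_price t \<omega> - log_price s \<omega>))"
    and "expectation (\<lambda>\<omega>. reflection_payoff (log_price t \<omega> - log_price s \<omega>)) = 1"
  using reflection_payoff_normal[OF _ distributed_log_price_increment[OF assms], of 0] assms vol_pos
  by (simp_all add: crossing_prob_0)

lemma reflection_payoff_level:
  assumes "0 < t"
  shows "integrable M (\<lambda>\<omega>. reflection_payoff (log_price t \<omega> - a))"
    and "expectation (\<lambda>\<omega>. reflection_payoff (log_price t \<omega> - a)) = crossing_prob (\<sigma> * sqrt t) a"
  using reflection_payoff_normal[OF _ distributed_log_price_increment[of 0 t], of a] assms vol_pos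
  by simp_all

text \<open>The event is decided by the increments up to \<open>p k\<close>, the payoff by the
  increment after it, which is independent and has expected payoff 1. The grid reduces this to
  disjoint blocks of increments, the form in which \<open>brownian_motion\<close> provides
  independence.\<close>

lemma expectation_first_hit_payoff:
  fixes p :: "nat \<Rightarrow> real" and k :: nat and b T :: real
  assumes p0: "p 0 = 0" and mono: "\<And>i. i < k \<Longrightarrow> p i \<le> p (Suc i)" and T: "p k < T"
  defines "E \<equiv> \<lambda>\<omega>. (\<forall>j<k. log_price (p j) \<omega> < b) \<and> b \<le> log_price (p k) \<omega>"
  shows "integrable M (\<lambda>\<omega>. if E \<omega> then reflection_payoff (log_price T \<omega> - log_price (p k) \<omega>) else 0)"
    and "expectation (\<lambda>\<omega>. if E \<omega> then reflection_payoff (log_price T \<omega> - log_price (p k) \<omega>) else 0)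
      = prob {\<omega>\<in>space M. E \<omega>}"
proof -
  have p_nonneg: "0 \<le> p j" if "j \<le> k" for j
    using that by (induction j) (use p0 mono in \<open>auto intro: order_trans\<close>)
  \<comment> \<open>The grid up to \<open>p k\<close>, followed by \<open>T\<close>: increment
    number \<open>k\<close> spans the rest of the horizon in one step.\<close>
  define q where "q i = (if i \<le> k then p i else T)" for i
  define D where "D i \<omega> = W (q (Suc i)) \<omega> - W (q i) \<omega>" for i \<omega>
  \<comment> \<open>\<open>h j\<close> rebuilds the log-price at \<open>p j\<close> from the
    increments, so that \<open>f\<close> (the event) and \<open>g\<close> (the payoff) are functions
    of disjoint blocks of coordinates.\<close>
  define h where "h j x = \<sigma> * (\<Sum>i<j. x i) - \<sigma>\<^sup>2 / 2 * p j" for j and x :: "nat \<Rightarrow> real"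
  define f :: "(nat \<Rightarrow> real) \<Rightarrow> real" where
    "f x = (if (\<forall>j\<in>{..<k}. h j x < b) \<and> b \<le> h k x then 1 else 0)" for x
  define g where "g x = reflection_payoff (\<sigma> * x k - \<sigma>\<^sup>2 / 2 * (T - p k))" for x :: "nat \<Rightarrow> real"
  have "0 \<le> q 0 \<and> (\<forall>i<Suc k. q i \<le> q (Suc i))"
    using p0 mono T by (auto simp: q_def less_Suc_eq)
  then have "indep_vars (\<lambda>_. borel) D {..<Suc k}"
    using bm unfolding brownian_motion_def D_def by blast
  then have ind: "indep_var (PiM {..<k} (\<lambda>_. borel)) (\<lambda>\<omega>. restrict (\<lambda>i. D i \<omega>) {..<k})
      (PiM {k} (\<lambda>_. borel)) (\<lambda>\<omega>. restrict (\<lambda>i. D i \<omega>) {k})"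
    by (intro indep_var_restrict) auto
  have h_meas: "h j \<in> borel_measurable (PiM {..<k} (\<lambda>_. borel))" if "j \<le> k" for j
  proof -
    have "(\<lambda>x. \<Sum>i<j. x i) \<in> borel_measurable (PiM {..<k} (\<lambda>_. borel :: real measure))"
      using that by (intro borel_measurable_sum measurable_component_singleton) auto
    then show ?thesis
      unfolding h_def by measurable
  qed
  have "Measurable.pred (PiM {..<k} (\<lambda>_. borel)) (\<lambda>x. h j x < b)"
    "Measurable.pred (PiM {..<k} (\<lambda>_. borel)) (\<lambda>x. b \<le> h j x)" if "j \<le> k" for j
    using h_meas[OF that] by measurable
  then have "Measurable.pred (PiM {..<k} (\<lambda>_. borel)) (\<lambda>x. (\<forall>j\<in>{..<k}. h j x < b) \<and> b \<le> h k x)"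
    by (intro pred_intros_logic pred_intros_finite) auto
  then have f_meas: "f \<in> borel_measurable (PiM {..<k} (\<lambda>_. borel))"
    unfolding f_def by measurable
  have g_meas: "g \<in> borel_measurable (PiM {k} (\<lambda>_. borel))"
  proof -
    have "(\<lambda>x. x k) \<in> borel_measurable (PiM {k} (\<lambda>_. borel :: real measure))"
      by (intro measurable_component_singleton) auto
    then show ?thesis
      unfolding g_def by measurable
  qed
  have telescope: "h j (restrict (\<lambda>i. D i \<omega>) {..<k}) = log_price (p j) \<omega>" if "j \<le> k" for j \<omega>
  proof -
    have "(\<Sum>i<j. restrict (\<lambda>i. D i \<omega>) {..<k} i) = (\<Sum>i<j. W (p (Suc i)) \<omega> - W (p i) \<omega>)"
      using that by (intro sum.cong) (auto simp: D_def q_def)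
    also have "\<dots> = W (p j) \<omega> - W 0 \<omega>"
      using sum_lessThan_telescope[of "\<lambda>i. W (p i) \<omega>" j] p0 by simp
    finally show ?thesis
      by (simp add: h_def log_price_def)
  qed
  have f_eq: "f (restrict (\<lambda>i. D i \<omega>) {..<k}) = indicator {\<omega>\<in>space M. E \<omega>} \<omega>"
    if "\<omega> \<in> space M" for \<omega>
    using that by (auto simp: f_def E_def telescope indicator_def)
  have g_eq: "g (restrict (\<lambda>i. D i \<omega>) {k}) = reflection_payoff (log_price T \<omega> - log_price (p k) \<omega>)" for \<omega>
  proof -
    have "\<sigma> * (W T \<omega> - W (p k) \<omega>) - \<sigma>\<^sup>2 / 2 * (T - p k) = log_price T \<omega> - log_price (p k) \<omega>"
      by (simp add: log_price_def field_simps)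
    then show ?thesis
      by (simp add: g_def D_def q_def)
  qed
  have ind': "indep_var borel (f \<circ> (\<lambda>\<omega>. restrict (\<lambda>i. D i \<omega>) {..<k}))
      borel (g \<circ> (\<lambda>\<omega>. restrict (\<lambda>i. D i \<omega>) {k}))"
    by (rule indep_var_compose[OF ind f_meas g_meas])
  have payoff: "integrable M (g \<circ> (\<lambda>\<omega>. restrict (\<lambda>i. D i \<omega>) {k}))"
    "expectation (g \<circ> (\<lambda>\<omega>. restrict (\<lambda>i. D i \<omega>) {k})) = 1"
    using reflection_payoff_increment[OF p_nonneg[OF order_refl] T] by (simp_all add: comp_def g_eq)
  have "{\<omega>\<in>space M. E \<omega>} \<in> events"
  proof -
    have "Measurable.pred M (\<lambda>\<omega>. log_price (p j) \<omega> < b)" "Measurable.pred M (\<lambda>\<omega>. b \<le> log_price (p j) \<omega>)"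
      if "j \<le> k" for j
      using borel_measurable_log_price[OF p_nonneg[OF that]] by measurable
    then have "Measurable.pred M (\<lambda>\<omega>. (\<forall>j\<in>{..<k}. log_price (p j) \<omega> < b) \<and> b \<le> log_price (p k) \<omega>)"
      by (intro pred_intros_logic pred_intros_finite) auto
    then show ?thesis
      unfolding E_def by (simp only: pred_def Ball_def lessThan_iff)
  qed
  then have hit: "integrable M (f \<circ> (\<lambda>\<omega>. restrict (\<lambda>i. D i \<omega>) {..<k}))"
    "expectation (f \<circ> (\<lambda>\<omega>. restrict (\<lambda>i. D i \<omega>) {..<k})) = prob {\<omega>\<in>space M. E \<omega>}"
  proof -
    have int: "integrable M (indicator {\<omega>\<in>space M. E \<omega>} :: _ \<Rightarrow> real)"
      using \<open>{\<omega>\<in>space M. E \<omega>} \<in> events\<close>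
      by (rule integrable_real_indicator) (simp add: emeasure_eq_measure)
    have f_eq': "(f \<circ> (\<lambda>\<omega>. restrict (\<lambda>i. D i \<omega>) {..<k})) \<omega> = indicator {\<omega>\<in>space M. E \<omega>} \<omega>"
      if "\<omega> \<in> space M" for \<omega>
      unfolding comp_def by (rule f_eq[OF that])
    show "integrable M (f \<circ> (\<lambda>\<omega>. restrict (\<lambda>i. D i \<omega>) {..<k}))"
      using Bochner_Integration.integrable_cong[OF refl f_eq'] int by (rule iffD2)
    show "expectation (f \<circ> (\<lambda>\<omega>. restrict (\<lambda>i. D i \<omega>) {..<k})) = prob {\<omega>\<in>space M. E \<omega>}"
      using \<open>{\<omega>\<in>space M. E \<omega>} \<in> events\<close>
      by (subst Bochner_Integration.integral_cong[OF refl f_eq']) (assumption, simp)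
  qed
  have eq: "(f \<circ> (\<lambda>\<omega>. restrict (\<lambda>i. D i \<omega>) {..<k})) \<omega> * (g \<circ> (\<lambda>\<omega>. restrict (\<lambda>i. D i \<omega>) {k})) \<omega>
      = (if E \<omega> then reflection_payoff (log_price T \<omega> - log_price (p k) \<omega>) else 0)" if "\<omega> \<in> space M" for \<omega>
    unfolding comp_def f_eq[OF that] g_eq using that by (simp add: indicator_def)
  show "integrable M (\<lambda>\<omega>. if E \<omega> then reflection_payoff (log_price T \<omega> - log_price (p k) \<omega>) else 0)"
    using Bochner_Integration.integrable_cong[OF refl eq] indep_var_integrable[OF ind' hit(1) payoff(1)]
    by (rule iffD1)
  have "expectation (\<lambda>\<omega>. if E \<omega> then reflection_payoff (log_price T \<omega> - log_price (p k) \<omega>) else 0)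
      = expectation (\<lambda>\<omega>. (f \<circ> (\<lambda>\<omega>. restrict (\<lambda>i. D i \<omega>) {..<k})) \<omega>
          * (g \<circ> (\<lambda>\<omega>. restrict (\<lambda>i. D i \<omega>) {k})) \<omega>)"
    by (rule Bochner_Integration.integral_cong[OF refl eq, symmetric])
  also have "\<dots> = prob {\<omega>\<in>space M. E \<omega>}"
    unfolding indep_var_lebesgue_integral[OF ind' hit(1) payoff(1)] hit(2) payoff(2) by (rule mult_1_right)
  finally show "expectation (\<lambda>\<omega>. if E \<omega> then reflection_payoff (log_price T \<omega> - log_price (p k) \<omega>) else 0)
      = prob {\<omega>\<in>space M. E \<omega>}" .
qed

text \<open>The grid leaves out \<open>T\<close>, where the expected payoff at the level would be 2 instead of 1.\<close>

lemma grid_crossing_bounds: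
  fixes T :: real and n :: nat
  assumes T: "0 < T" and n: "0 < n"
  defines "p \<equiv> \<lambda>k. T * real k / real n"
  shows "prob {\<omega>\<in>space M. \<exists>k<n. b \<le> log_price (p k) \<omega>} \<le> crossing_prob (\<sigma> * sqrt T) b"
    and "0 \<le> b \<Longrightarrow> 0 \<le> \<delta> \<Longrightarrow> crossing_prob (\<sigma> * sqrt T) (b + \<delta>)
      \<le> prob {\<omega>\<in>space M. \<exists>k<n. b \<le> log_price (p k) \<omega>}
        + expectation (\<lambda>\<omega>. if \<exists>k<n. \<delta> \<le> log_price (p (Suc k)) \<omega> - log_price (p k) \<omega>
            then reflection_payoff (log_price T \<omega> - (b + \<delta>)) else 0)"
proof -
  define E where "E k \<omega> \<longleftrightarrow> (\<forall>j<k. log_price (p j) \<omega> < b) \<and> b \<le> log_price (p k) \<omega>" for k \<omega>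
  define A where "A \<omega> \<longleftrightarrow> (\<exists>k<n. b \<le> log_price (p k) \<omega>)" for \<omega>
  define H where "H \<omega> = (LEAST k. b \<le> log_price (p k) \<omega>)" for \<omega>
  define Y where "Y \<omega> = (\<Sum>k<n. if E k \<omega> then reflection_payoff (log_price T \<omega> - log_price (p k) \<omega>) else 0)" for \<omega>
  have p: "p 0 = 0" "\<And>i. 0 \<le> p i" "\<And>i. p i \<le> p (Suc i)" "p n = T" "\<And>k. k < n \<Longrightarrow> p k < T"
    using T n by (auto simp: p_def field_simps)
  have X_meas [measurable]: "log_price (p k) \<in> borel_measurable M" "log_price T \<in> borel_measurable M" for k
    using p T by (auto intro: borel_measurable_log_price)
  have A_meas: "{\<omega>\<in>space M. A \<omega>} \<in> events" and E_meas: "{\<omega>\<in>space M. E k \<omega>} \<in> events" for k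
    unfolding A_def E_def by measurable
  have Y_eq: "Y \<omega> = (if A \<omega> then reflection_payoff (log_price T \<omega> - log_price (p (H \<omega>)) \<omega>) else 0)" for \<omega>
    unfolding Y_def A_def H_def E_def by (rule sum_first_hit)
  have H: "b \<le> log_price (p (H \<omega>)) \<omega>" "H \<omega> < n" "\<And>j. j < H \<omega> \<Longrightarrow> log_price (p j) \<omega> < b" if A: "A \<omega>" for \<omega>
  proof -
    from A obtain k where k: "k < n" "b \<le> log_price (p k) \<omega>"
      by (auto simp: A_def)
    show "b \<le> log_price (p (H \<omega>)) \<omega>"
      unfolding H_def using k(2) by (rule LeastI)
    show "H \<omega> < n"
      using Least_le[of "\<lambda>k. b \<le> log_price (p k) \<omega>" k] k by (simp add: H_def)
    show "log_price (p j) \<omega> < b" if "j < H \<omega>" for j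
      using not_less_Least[of j "\<lambda>k. b \<le> log_price (p k) \<omega>"] that by (simp add: H_def)
  qed
  have step: "integrable M (\<lambda>\<omega>. if E k \<omega> then reflection_payoff (log_price T \<omega> - log_price (p k) \<omega>) else 0)"
    "expectation (\<lambda>\<omega>. if E k \<omega> then reflection_payoff (log_price T \<omega> - log_price (p k) \<omega>) else 0)
      = prob {\<omega>\<in>space M. E k \<omega>}" if "k < n" for k
    unfolding E_def using expectation_first_hit_payoff[of p k T b] p that by auto
  have Y_int: "integrable M Y"
    unfolding Y_def using step(1) by (intro Bochner_Integration.integrable_sum) auto
  have "expectation Y = (\<Sum>k<n. prob {\<omega>\<in>space M. E k \<omega>})"
    unfolding Y_def using step by (subst Bochner_Integration.integral_sum) auto
  also have "\<dots> = expectation (\<lambda>\<omega>. \<Sum>k<n. indicator {\<omega>\<in>space M. E k \<omega>} \<omega>)"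
    using E_meas
    by (subst Bochner_Integration.integral_sum)
      (auto intro!: integrable_real_indicator simp: emeasure_eq_measure)
  also have "\<dots> = expectation (indicator {\<omega>\<in>space M. A \<omega>})"
  proof (rule Bochner_Integration.integral_cong)
    fix \<omega> assume "\<omega> \<in> space M"
    then have "(\<Sum>k<n. indicator {\<omega>\<in>space M. E k \<omega>} \<omega>) = (\<Sum>k<n. if E k \<omega> then 1 else (0 :: real))"
      by (intro sum.cong) (simp_all add: indicator_def)
    also have "\<dots> = (if A \<omega> then 1 else 0)"
      unfolding E_def A_def by (rule sum_first_hit)
    finally show "(\<Sum>k<n. indicator {\<omega>\<in>space M. E k \<omega>} \<omega>) = (indicator {\<omega>\<in>space M. A \<omega>} \<omega> :: real)"
      using \<open>\<omega> \<in> space M\<close> by (simp add: indicator_def)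
  qed simp
  also have "\<dots> = prob {\<omega>\<in>space M. A \<omega>}"
    using A_meas by simp
  finally have EY: "expectation Y = prob {\<omega>\<in>space M. A \<omega>}" .
  \<comment> \<open>At the hit the log-price is at least \<open>b\<close>, so measuring from it
    instead of from \<open>b\<close> can only lower the monotone payoff.\<close>
  have "Y \<omega> \<le> reflection_payoff (log_price T \<omega> - b)" for \<omega>
    using monoD[OF mono_reflection_payoff, of "log_price T \<omega> - log_price (p (H \<omega>)) \<omega>" "log_price T \<omega> - b"] H(1)[of \<omega>]
    by (simp add: Y_eq reflection_payoff_nonneg)
  then have "expectation Y \<le> expectation (\<lambda>\<omega>. reflection_payoff (log_price T \<omega> - b))"
    using Y_int reflection_payoff_level(1)[OF T] by (intro integral_mono) auto
  then show "prob {\<omega>\<in>space M. \<exists>k<n. b \<le> log_price (p k) \<omega>} \<le> crossing_prob (\<sigma> * sqrt T) b"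
    using EY reflection_payoff_level(2)[OF T] by (simp add: A_def)
  assume b: "0 \<le> b" and \<delta>: "0 \<le> \<delta>"
  \<comment> \<open>The error term: paths with a large grid increment, on which the overshoot over
    \<open>b\<close> is not controlled by \<open>\<delta>\<close>.\<close>
  define Z where "Z \<omega> = (if \<exists>k<n. \<delta> \<le> log_price (p (Suc k)) \<omega> - log_price (p k) \<omega>
    then reflection_payoff (log_price T \<omega> - (b + \<delta>)) else 0)" for \<omega>
  have [measurable]: "Z \<in> borel_measurable M"
    unfolding Z_def by measurable
  have Z_int: "integrable M Z"
    using reflection_payoff_level(1)[OF T]
    by (rule Bochner_Integration.integrable_bound)
      (auto simp: Z_def reflection_payoff_nonneg)
  have "reflection_payoff (log_price T \<omega> - (b + \<delta>)) \<le> Y \<omega> + Z \<omega>" for \<omega>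
  proof (cases "log_price T \<omega> < b + \<delta> \<or> (\<exists>k<n. \<delta> \<le> log_price (p (Suc k)) \<omega> - log_price (p k) \<omega>)")
    case True
    moreover have "reflection_payoff (log_price T \<omega> - (b + \<delta>)) = 0" if "log_price T \<omega> < b + \<delta>"
      using that by (simp add: reflection_payoff_def)
    ultimately show ?thesis
      by (auto simp: Y_eq Z_def reflection_payoff_nonneg)
  next
    case False
    then have incr: "log_price (p (Suc k)) \<omega> < log_price (p k) \<omega> + \<delta>" if "k < n" for k
      using that by (force simp: not_le)
    have XT: "b + \<delta> \<le> log_price T \<omega>"
      using False by simp
    \<comment> \<open>Since \<open>p n = T\<close>, a final value of at least
      \<open>b + \<delta>\<close> and a last increment below \<open>\<delta>\<close> put the grid
      point just before \<open>T\<close> above \<open>b\<close>.\<close>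
    have A: "A \<omega>"
      using incr[of "n - 1"] XT n p(4) unfolding A_def by (intro exI[of _ "n - 1"]) auto
    \<comment> \<open>Overshoot bound: the grid point before the first hit is below
      \<open>b\<close>, and one increment adds less than \<open>\<delta>\<close>. A hit at index 0
      forces \<open>b = 0\<close>, since the path starts at 0.\<close>
    have "log_price (p (H \<omega>)) \<omega> \<le> b + \<delta>"
    proof (cases "H \<omega>")
      case 0
      then have "b = 0"
        using H(1)[OF A] p(1) b by simp
      then show ?thesis using 0 p(1) \<delta> by simp
    next
      case (Suc j)
      then show ?thesis
        using H(2)[OF A] H(3)[OF A, of j] incr[of j] by simp
    qed
    then have "reflection_payoff (log_price T \<omega> - (b + \<delta>)) \<le> reflection_payoff (log_price T \<omega> - log_price (p (H \<omega>)) \<omega>)"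
      by (intro monoD[OF mono_reflection_payoff]) simp
    then show ?thesis
      using A by (simp add: Y_eq Z_def reflection_payoff_nonneg)
  qed
  then have "expectation (\<lambda>\<omega>. reflection_payoff (log_price T \<omega> - (b + \<delta>))) \<le> expectation (\<lambda>\<omega>. Y \<omega> + Z \<omega>)"
    using Y_int Z_int reflection_payoff_level(1)[OF T] by (intro integral_mono) auto
  also have "\<dots> = prob {\<omega>\<in>space M. A \<omega>} + expectation Z"
    unfolding EY[symmetric] by (rule Bochner_Integration.integral_add[OF Y_int Z_int])
  finally show "crossing_prob (\<sigma> * sqrt T) (b + \<delta>)
      \<le> prob {\<omega>\<in>space M. \<exists>k<n. b \<le> log_price (p k) \<omega>}
        + expectation (\<lambda>\<omega>. if \<exists>k<n. \<delta> \<le> log_price (p (Suc k)) \<omega> - log_price (p k) \<omega>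
            then reflection_payoff (log_price T \<omega> - (b + \<delta>)) else 0)"
    unfolding reflection_payoff_level(2)[OF T] A_def Z_def[abs_def] .
qed

end

lemma continuous_grid_approx:
  fixes f :: "real \<Rightarrow> real"
  assumes cont: "continuous_on {0..} f" and t: "0 \<le> t" "t \<le> T" and T: "0 < T" and e: "0 < e"
  shows "\<forall>\<^sub>F n in sequentially. \<exists>k<n. \<bar>f (T * real k / real n) - f t\<bar> < e"
proof -
  obtain d where d: "0 < d" "\<And>s. 0 \<le> s \<Longrightarrow> \<bar>s - t\<bar> < d \<Longrightarrow> \<bar>f s - f t\<bar> < e"
    using cont t(1) e unfolding continuous_on_iff by (force simp: dist_real_def)
  have "\<exists>k<n. \<bar>f (T * real k / real n) - f t\<bar> < e" if n: "n > nat \<lceil>T / d\<rceil>" for n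
  proof -
    have n0: "0 < real n"
      using n by simp
    have "T / d < real n"
      using n by linarith
    then have nT: "T < d * real n"
      using d(1) by (simp add: field_simps)
    \<comment> \<open>The last grid index not after \<open>t\<close>, capped at \<open>n - 1\<close>
      because the grid stops short of \<open>T\<close>; its time stays within one mesh width of
      \<open>t\<close> even for \<open>t = T\<close>.\<close>
    define k where "k = min (nat \<lfloor>t * n / T\<rfloor>) (n - 1)"
    have "real k \<le> t * n / T"
    proof -
      have "real (nat \<lfloor>t * n / T\<rfloor>) \<le> t * n / T"
        using t T by (intro of_nat_floor) simp
      then show ?thesis unfolding k_def by linarith
    qed
    moreover have "t * n / T \<le> real k + 1"
    proof (cases "nat \<lfloor>t * n / T\<rfloor> \<le> n - 1")
      case True
      then show ?thesis unfolding k_def by linarith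
    next
      case False
      moreover have "t * n / T \<le> n"
        using t T n0 by (simp add: field_simps)
      ultimately show ?thesis unfolding k_def using n0 by linarith
    qed
    ultimately have "T * real k \<le> t * n" "t * n \<le> T * real k + T"
      using T by (simp_all add: field_simps)
    then have "T * real k / real n \<le> t" "t \<le> (T * real k + T) / real n"
      using n0 by (simp_all add: pos_divide_le_eq pos_le_divide_eq)
    then have "\<bar>T * real k / real n - t\<bar> \<le> T / n"
      by (simp add: add_divide_distrib)
    also have "\<dots> < d"
      using nT n0 by (simp add: field_simps)
    finally have "\<bar>f (T * real k / real n) - f t\<bar> < e"
      using d(2) T by simp
    moreover have "k < n"
      using n0 by (auto simp: k_def)
    ultimately show ?thesis by blast
  qed
  then show ?thesis
    unfolding eventually_sequentially by (intro exI[of _ "Suc (nat \<lceil>T / d\<rceil>)"]) auto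
qed

text \<open>Uniform continuity on the compact interval. It makes the large-increment event of the
  lower bound disappear path by path.\<close>

lemma continuous_grid_increments:
  fixes f :: "real \<Rightarrow> real"
  assumes cont: "continuous_on {0..} f" and T: "0 < T" and e: "0 < e"
  shows "\<forall>\<^sub>F n in sequentially.
    \<forall>k<n. \<bar>f (T * real (Suc k) / real n) - f (T * real k / real n)\<bar> < e"
proof -
  have "uniformly_continuous_on {0..T} f"
    using cont by (intro compact_uniformly_continuous) (auto intro: continuous_on_subset)
  then obtain d where d: "0 < d"
    "\<And>s t. s \<in> {0..T} \<Longrightarrow> t \<in> {0..T} \<Longrightarrow> \<bar>s - t\<bar> < d \<Longrightarrow> \<bar>f s - f t\<bar> < e"
    using e unfolding uniformly_continuous_on_def by (metis dist_real_def)
  have "\<bar>f (T * real (Suc k) / real n) - f (T * real k / real n)\<bar> < e"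
    if n: "n > nat \<lceil>T / d\<rceil>" and k: "k < n" for n k
  proof (rule d(2))
    have n0: "0 < real n"
      using k by simp
    have "T / d < real n"
      using n by linarith
    then show "\<bar>T * real (Suc k) / real n - T * real k / real n\<bar> < d"
      using d(1) n0 T by (simp add: field_simps)
    have "real k \<le> n" "real (Suc k) \<le> n"
      using k by linarith+
    then show "T * real (Suc k) / real n \<in> {0..T}" "T * real k / real n \<in> {0..T}"
      using n0 T by (simp_all add: field_simps del: of_nat_Suc)
  qed
  then show ?thesis
    unfolding eventually_sequentially by (intro exI[of _ "Suc (nat \<lceil>T / d\<rceil>)"]) auto
qed

text \<open>An uncountable union of events is rewritten with countable quantifiers: a continuous
  path reaches \<open>b\<close> up to time \<open>T\<close> exactly when, for every
  \<open>m\<close>, some grid point reaches \<open>b - 1 / real (Suc m)\<close>.\<close>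

lemma sets_continuous_crossing:
  fixes Y :: "real \<Rightarrow> 'a \<Rightarrow> real"
  assumes meas: "\<And>t. 0 \<le> t \<Longrightarrow> Y t \<in> borel_measurable M"
    and cont: "\<And>\<omega>. \<omega> \<in> space M \<Longrightarrow> continuous_on {0..} (\<lambda>t. Y t \<omega>)" and T: "0 < T"
  shows "{\<omega>\<in>space M. \<exists>t\<in>{0..T}. b \<le> Y t \<omega>} \<in> sets M"
proof -
  define p where "p n k = T * real k / real (Suc n)" for n k
  have p: "p n k \<in> {0..T}" if "k < Suc n" for n k
  proof -
    have "T * real k \<le> T * real (Suc n)"
      using T that by (intro mult_left_mono) auto
    then show ?thesis
      using T by (simp add: p_def pos_divide_le_eq)
  qed
  have iff: "(\<exists>t\<in>{0..T}. b \<le> Y t \<omega>) \<longleftrightarrow> (\<forall>m. \<exists>n. \<exists>k\<in>{..<Suc n}. b - 1 / real (Suc m) \<le> Y (p n k) \<omega>)"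
    if \<omega>: "\<omega> \<in> space M" for \<omega>
  proof safe
    fix t m assume t: "t \<in> {0..T}" "b \<le> Y t \<omega>"
    have "\<forall>\<^sub>F n in sequentially. \<exists>k<n. \<bar>Y (T * real k / real n) \<omega> - Y t \<omega>\<bar> < 1 / real (Suc m)"
      using t T by (intro continuous_grid_approx cont[OF \<omega>]) auto
    then obtain N where "\<forall>n\<ge>N. \<exists>k<n. \<bar>Y (T * real k / real n) \<omega> - Y t \<omega>\<bar> < 1 / real (Suc m)"
      unfolding eventually_sequentially by blast
    then obtain k where k: "k < Suc N" "\<bar>Y (p N k) \<omega> - Y t \<omega>\<bar> < 1 / real (Suc m)"
      unfolding p_def by (meson le_SucI order_refl)
    then show "\<exists>n. \<exists>k\<in>{..<Suc n}. b - 1 / real (Suc m) \<le> Y (p n k) \<omega>"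
      using t(2) by (intro exI[of _ N] bexI[of _ k]) auto
  next
    assume *: "\<forall>m. \<exists>n. \<exists>k\<in>{..<Suc n}. b - 1 / real (Suc m) \<le> Y (p n k) \<omega>"
    \<comment> \<open>Compactness enters here: the maximum is attained and exceeds every grid value,
      so it is at least the limit \<open>b\<close> of the lowered levels.\<close>
    have "\<exists>t\<in>{0..T}. \<forall>s\<in>{0..T}. Y s \<omega> \<le> Y t \<omega>"
      using T cont[OF \<omega>] by (intro continuous_attains_sup) (auto intro: continuous_on_subset)
    then obtain t where t: "t \<in> {0..T}" "\<And>s. s \<in> {0..T} \<Longrightarrow> Y s \<omega> \<le> Y t \<omega>"
      by blast
    have "b - 1 / real (Suc m) \<le> Y t \<omega>" for m
      using * p t(2) by (meson lessThan_iff order_trans)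
    moreover have "(\<lambda>m. b - 1 / real (Suc m)) \<longlonglongrightarrow> b - 0"
      by (intro tendsto_diff tendsto_const LIMSEQ_Suc[OF lim_1_over_n])
    ultimately have "b - 0 \<le> Y t \<omega>"
      by (intro LIMSEQ_le_const2) auto
    then show "\<exists>t\<in>{0..T}. b \<le> Y t \<omega>"
      using t(1) by auto
  qed
  have eq: "{\<omega>\<in>space M. \<exists>t\<in>{0..T}. b \<le> Y t \<omega>}
      = {\<omega>\<in>space M. \<forall>m. \<exists>n. \<exists>k\<in>{..<Suc n}. b - 1 / real (Suc m) \<le> Y (p n k) \<omega>}"
    by (rule Collect_cong, rule conj_cong[OF refl], erule iff)
  have "Measurable.pred M (\<lambda>\<omega>. b - 1 / real (Suc m) \<le> Y (p n k) \<omega>)" if "k < Suc n" for m n k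
  proof -
    have [measurable]: "Y (p n k) \<in> borel_measurable M"
      using p[OF that] by (intro meas) simp
    show ?thesis by measurable
  qed
  then have "Measurable.pred M
      (\<lambda>\<omega>. \<forall>m. \<exists>n. \<exists>k\<in>{..<Suc n}. b - 1 / real (Suc m) \<le> Y (p n k) \<omega>)"
    by (intro pred_intros_countable pred_intros_finite) auto
  then show ?thesis
    unfolding eq by (simp only: pred_def)
qed

section \<open>From the grid to continuous time\<close>

context driftless_gbm
begin

lemma sets_crossing: "0 < T \<Longrightarrow> {\<omega>\<in>space M. \<exists>t\<in>{0..T}. b \<le> log_price t \<omega>} \<in> sets M"
  by (rule sets_continuous_crossing) (auto intro: borel_measurable_log_price continuous_on_log_price)

text \<open>A path may touch \<open>b\<close> between grid points, so the grid is tested at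
  \<open>b - \<delta>\<close>, which every crossing path reaches on all sufficiently fine grids.
  This level may be negative, which the upper grid bound allows.\<close>

lemma prob_crossing_le:
  assumes T: "0 < T" and \<delta>: "0 < \<delta>"
  shows "prob {\<omega>\<in>space M. \<exists>t\<in>{0..T}. b \<le> log_price t \<omega>} \<le> crossing_prob (\<sigma> * sqrt T) (b - \<delta>)"
proof -
  define B where "B = {\<omega>\<in>space M. \<exists>t\<in>{0..T}. b \<le> log_price t \<omega>}"
  define A where "A n = {\<omega>\<in>space M. \<exists>k<n. b - \<delta> \<le> log_price (T * real k / real n) \<omega>}" for n
  have B: "B \<in> events"
    unfolding B_def using T by (rule sets_crossing)
  have A: "A n \<in> events" for n
  proof -
    have [measurable]: "log_price (T * real k / real n) \<in> borel_measurable M" for k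
      using T by (intro borel_measurable_log_price) simp
    show ?thesis unfolding A_def by measurable
  qed
  have "(\<lambda>n. expectation (indicator (B - A n))) \<longlonglongrightarrow> expectation (\<lambda>_. 0 :: real)"
  proof (rule integral_dominated_convergence[where w = "\<lambda>_. 1"])
    show "AE \<omega> in M. (\<lambda>n. indicator (B - A n) \<omega>) \<longlonglongrightarrow> (0 :: real)"
    proof (rule AE_I2)
      fix \<omega> assume \<omega>: "\<omega> \<in> space M"
      have "\<forall>\<^sub>F n in sequentially. indicator (B - A n) \<omega> = (0 :: real)"
      proof (cases "\<omega> \<in> B")
        case True
        then obtain t where t: "0 \<le> t" "t \<le> T" "b \<le> log_price t \<omega>"
          by (auto simp: B_def)
        have "\<forall>\<^sub>F n in sequentially. \<exists>k<n. \<bar>log_price (T * real k / real n) \<omega> - log_price t \<omega>\<bar> < \<delta>"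
          using t T \<delta> by (intro continuous_grid_approx continuous_on_log_price \<omega>)
        then show ?thesis
        proof (rule eventually_mono)
          fix n assume "\<exists>k<n. \<bar>log_price (T * real k / real n) \<omega> - log_price t \<omega>\<bar> < \<delta>"
          then obtain k where "k < n" "\<bar>log_price (T * real k / real n) \<omega> - log_price t \<omega>\<bar> < \<delta>"
            by blast
          then have "\<omega> \<in> A n"
            unfolding A_def using t(3) \<omega> by (auto intro!: exI[of _ k])
          then show "indicator (B - A n) \<omega> = (0 :: real)"
            by simp
        qed
      qed simp
      then show "(\<lambda>n. indicator (B - A n) \<omega>) \<longlonglongrightarrow> (0 :: real)"
        by (rule tendsto_eventually)
    qed
  qed (use A B in \<open>auto simp: indicator_def\<close>)
  moreover have "expectation (indicator (B - A n)) = prob (B - A n)" for n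
    using A B by simp
  ultimately have "(\<lambda>n. crossing_prob (\<sigma> * sqrt T) (b - \<delta>) + prob (B - A n))
      \<longlonglongrightarrow> crossing_prob (\<sigma> * sqrt T) (b - \<delta>) + 0"
    by (intro tendsto_add tendsto_const) simp
  moreover have "prob B \<le> crossing_prob (\<sigma> * sqrt T) (b - \<delta>) + prob (B - A n)" if "0 < n" for n
  proof -
    have "prob B \<le> prob (A n \<union> (B - A n))"
      using A B by (intro finite_measure_mono) auto
    also have "\<dots> \<le> prob (A n) + prob (B - A n)"
      using A B by (intro measure_Un_le) auto
    also have "prob (A n) \<le> crossing_prob (\<sigma> * sqrt T) (b - \<delta>)"
      unfolding A_def by (rule grid_crossing_bounds(1)[OF T that])
    finally show ?thesis by simp
  qed
  ultimately have "prob B \<le> crossing_prob (\<sigma> * sqrt T) (b - \<delta>) + 0"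
    by (intro LIMSEQ_le_const) (auto intro!: exI[of _ 1])
  then show ?thesis
    by (simp add: B_def)
qed

text \<open>A grid hit is a hit of the path, so only the error term of the lower grid bound has to
  vanish; it does so path by path, with the full payoff at \<open>T\<close> as integrable
  majorant.\<close>

lemma prob_crossing_ge:
  assumes T: "0 < T" and \<delta>: "0 < \<delta>" and b: "0 \<le> b"
  shows "crossing_prob (\<sigma> * sqrt T) (b + \<delta>) \<le> prob {\<omega>\<in>space M. \<exists>t\<in>{0..T}. b \<le> log_price t \<omega>}"
proof -
  define B where "B = {\<omega>\<in>space M. \<exists>t\<in>{0..T}. b \<le> log_price t \<omega>}"
  define J where "J n \<omega> = (if \<exists>k<n. \<delta> \<le> log_price (T * real (Suc k) / real n) \<omega> - log_price (T * real k / real n) \<omega>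
    then reflection_payoff (log_price T \<omega> - (b + \<delta>)) else 0)" for n \<omega>
  have B: "B \<in> events"
    unfolding B_def using T by (rule sets_crossing)
  have meas [measurable]: "log_price T \<in> borel_measurable M" "log_price (T * real k / real n) \<in> borel_measurable M" for k n
    using T by (auto intro!: borel_measurable_log_price)
  have "(\<lambda>n. expectation (J n)) \<longlonglongrightarrow> expectation (\<lambda>_. 0)"
  proof (rule integral_dominated_convergence[where w = "\<lambda>\<omega>. reflection_payoff (log_price T \<omega> - (b + \<delta>))"])
    show "integrable M (\<lambda>\<omega>. reflection_payoff (log_price T \<omega> - (b + \<delta>)))"
      using T by (rule reflection_payoff_level)
    show "J n \<in> borel_measurable M" for n
      unfolding J_def by measurable
    show "AE \<omega> in M. (\<lambda>n. J n \<omega>) \<longlonglongrightarrow> 0"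
    proof (rule AE_I2)
      fix \<omega> assume \<omega>: "\<omega> \<in> space M"
      have "\<forall>\<^sub>F n in sequentially.
          \<forall>k<n. \<bar>log_price (T * real (Suc k) / real n) \<omega> - log_price (T * real k / real n) \<omega>\<bar> < \<delta>"
        using T \<delta> by (intro continuous_grid_increments continuous_on_log_price \<omega>)
      then have "\<forall>\<^sub>F n in sequentially. J n \<omega> = 0"
      proof (rule eventually_mono)
        fix n assume "\<forall>k<n. \<bar>log_price (T * real (Suc k) / real n) \<omega> - log_price (T * real k / real n) \<omega>\<bar> < \<delta>"
        then have "\<not> (\<exists>k<n. \<delta> \<le> log_price (T * real (Suc k) / real n) \<omega> - log_price (T * real k / real n) \<omega>)"
          by (meson abs_less_iff not_le)
        then show "J n \<omega> = 0"
          unfolding J_def by (rule if_not_P)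
      qed
      then show "(\<lambda>n. J n \<omega>) \<longlonglongrightarrow> 0"
        by (rule tendsto_eventually)
    qed
    show "AE \<omega> in M. norm (J n \<omega>) \<le> reflection_payoff (log_price T \<omega> - (b + \<delta>))" for n
      by (rule AE_I2) (simp add: J_def reflection_payoff_nonneg)
  qed simp
  then have "(\<lambda>n. prob B + expectation (J n)) \<longlonglongrightarrow> prob B + 0"
    by (intro tendsto_add tendsto_const) simp
  moreover have "crossing_prob (\<sigma> * sqrt T) (b + \<delta>) \<le> prob B + expectation (J n)" if "0 < n" for n
  proof -
    have "prob {\<omega>\<in>space M. \<exists>k<n. b \<le> log_price (T * real k / real n) \<omega>} \<le> prob B"
    proof (intro finite_measure_mono B subsetI)
      fix \<omega> assume "\<omega> \<in> {\<omega>\<in>space M. \<exists>k<n. b \<le> log_price (T * real k / real n) \<omega>}"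
      then obtain k where "\<omega> \<in> space M" "k < n" "b \<le> log_price (T * real k / real n) \<omega>"
        by blast
      then show "\<omega> \<in> B"
        unfolding B_def using T by (auto intro!: bexI[of _ "T * real k / real n"] simp: field_simps)
    qed
    then show ?thesis
      using grid_crossing_bounds(2)[OF T that b, of \<delta>] \<delta> unfolding J_def by simp
  qed
  ultimately have "crossing_prob (\<sigma> * sqrt T) (b + \<delta>) \<le> prob B + 0"
    by (intro LIMSEQ_le_const) (auto intro!: exI[of _ 1])
  then show ?thesis
    by (simp add: B_def)
qed

text \<open>The two bounds carry the margin \<open>\<delta>\<close> on opposite sides of
  \<open>b\<close>; continuity of \<open>crossing_prob\<close> closes the gap.\<close>

theorem prob_crossing:
  assumes T: "0 < T" and b: "0 \<le> b"
  shows "prob {\<omega>\<in>space M. \<exists>t\<in>{0..T}. b \<le> log_price t \<omega>} = crossing_prob (\<sigma> * sqrt T) b"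
proof (rule antisym)
  have cont: "isCont (crossing_prob (\<sigma> * sqrt T)) b"
    using vol_pos T by (intro isCont_crossing_prob) simp
  have "(\<lambda>m. crossing_prob (\<sigma> * sqrt T) (b - 1 / real (Suc m))) \<longlonglongrightarrow> crossing_prob (\<sigma> * sqrt T) (b - 0)"
    using cont by (intro isCont_tendsto_compose[where g = "crossing_prob (\<sigma> * sqrt T)"]
        tendsto_diff tendsto_const LIMSEQ_Suc[OF lim_1_over_n]) simp
  then show "prob {\<omega>\<in>space M. \<exists>t\<in>{0..T}. b \<le> log_price t \<omega>} \<le> crossing_prob (\<sigma> * sqrt T) b"
    using prob_crossing_le[OF T] by (intro LIMSEQ_le_const) auto
  have "(\<lambda>m. crossing_prob (\<sigma> * sqrt T) (b + 1 / real (Suc m))) \<longlonglongrightarrow> crossing_prob (\<sigma> * sqrt T) (b + 0)"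
    using cont by (intro isCont_tendsto_compose[where g = "crossing_prob (\<sigma> * sqrt T)"]
        tendsto_add tendsto_const LIMSEQ_Suc[OF lim_1_over_n]) simp
  then show "crossing_prob (\<sigma> * sqrt T) b \<le> prob {\<omega>\<in>space M. \<exists>t\<in>{0..T}. b \<le> log_price t \<omega>}"
    using prob_crossing_ge[OF T _ b] by (intro LIMSEQ_le_const2) auto
qed

end

section \<open>The liquidation probability\<close>

text \<open>The set of crossing times of a continuous path is closed, so its infimum is attained
  when finite. Without continuity crossing times could decrease to \<open>T\<close> with no crossing
  at \<open>T\<close> itself.\<close>

lemma liquidation_time_le_iff:
  assumes cont: "continuous_on {0..} (\<lambda>t. X t \<omega>)"
  shows "liquidation_time l X \<omega> \<le> ereal T \<longleftrightarrow> (\<exists>t\<in>{0..T}. l \<le> X t \<omega>)"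
proof
  assume "\<exists>t\<in>{0..T}. l \<le> X t \<omega>"
  then obtain t where "0 \<le> t" "t \<le> T" "l \<le> X t \<omega>" by auto
  then have "liquidation_time l X \<omega> \<le> ereal t"
    unfolding liquidation_time_def by (intro Inf_lower) auto
  also have "\<dots> \<le> ereal T"
    using \<open>t \<le> T\<close> by simp
  finally show "liquidation_time l X \<omega> \<le> ereal T" .
next
  assume le: "liquidation_time l X \<omega> \<le> ereal T"
  show "\<exists>t\<in>{0..T}. l \<le> X t \<omega>"
  proof (rule ccontr)
    assume none: "\<not> (\<exists>t\<in>{0..T}. l \<le> X t \<omega>)"
    define K where "K = {t\<in>{0..}. l \<le> X t \<omega>}"
    have "K = {0..} \<inter> (\<lambda>t. X t \<omega>) -` {l..}"
      by (auto simp: K_def)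
    then have "closed K"
      using continuous_closed_preimage[OF cont closed_atLeast closed_atLeast] by simp
    have "T \<notin> K"
      using none by (auto simp: K_def)
    \<comment> \<open>A whole neighbourhood of \<open>T\<close> is free of crossings, so none comes
      before \<open>T + e\<close>.\<close>
    then obtain e where e: "0 < e" "ball T e \<subseteq> - K"
      using \<open>closed K\<close> open_contains_ball[of "- K"] by (auto simp: closed_def)
    have "ereal (T + e) \<le> liquidation_time l X \<omega>"
      unfolding liquidation_time_def
    proof (rule Inf_greatest)
      fix x assume "x \<in> {ereal t | t. 0 \<le> t \<and> l \<le> X t \<omega>}"
      then obtain t where t: "x = ereal t" "0 \<le> t" "l \<le> X t \<omega>" by auto
      then have "t \<notin> ball T e" "\<not> t \<le> T"
        using e(2) none by (auto simp: K_def)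
      then show "ereal (T + e) \<le> x"
        using t(1) by (auto simp: dist_real_def)
    qed
    also note le
    finally show False
      using e(1) by simp
  qed
qed

lemma liquidation_probability:
  fixes N :: "'b measure" and Wt :: "real \<Rightarrow> 'b \<Rightarrow> real"
  assumes "prob_space N" and bm: "brownian_motion N Wt" and \<sigma>: "0 < \<sigma>" and T: "0 < T"
    and L0: "0 < h * V0 / C" and l: "h * V0 / C \<le> l"
  shows "measure N {\<omega>\<in>space N.
      liquidation_time l (loan_to_value h V0 C (geometric_bm 2 0 \<sigma> Wt)) \<omega> \<le> ereal T}
    = crossing_prob (\<sigma> * sqrt T) (ln (l / (h * V0 / C)))"
proof -
  interpret prob_space N by fact
  interpret driftless_gbm N Wt \<sigma>
    by unfold_locales (fact bm \<sigma>)+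
  define b where "b = ln (l / (h * V0 / C))"
  \<comment> \<open>\<open>Y\<close> keeps \<open>Wt 0\<close>, as \<open>geometric_bm\<close> does,
    while \<open>log_price\<close> subtracts it. The two agree almost surely, and comparing the
    crossing probabilities calls for measurability of both events.\<close>
  define Y where "Y t \<omega> = \<sigma> * Wt t \<omega> - \<sigma>\<^sup>2 / 2 * t" for t \<omega>
  have b: "0 \<le> b"
    unfolding b_def using L0 l by (intro ln_ge_zero) (simp only: le_divide_eq_1_pos)
  have contW: "continuous_on {0..} (\<lambda>t. Wt t \<omega>)" if "\<omega> \<in> space N" for \<omega>
    using bm that by (simp add: brownian_motion_def)
  have contY: "continuous_on {0..} (\<lambda>t. Y t \<omega>)" if "\<omega> \<in> space N" for \<omega>
    unfolding Y_def by (intro continuous_intros contW that)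
  \<comment> \<open>The initial value 2 of the approximating process cancels the 2 in the
    denominator of \<open>loan_to_value\<close>.\<close>
  have LTV: "loan_to_value h V0 C (geometric_bm 2 0 \<sigma> Wt) t \<omega> = h * V0 / C * exp (Y t \<omega>)" for t \<omega>
    by (simp add: loan_to_value_def geometric_bm_def Y_def algebra_simps)
  have contL: "continuous_on {0..} (\<lambda>t. loan_to_value h V0 C (geometric_bm 2 0 \<sigma> Wt) t \<omega>)"
    if "\<omega> \<in> space N" for \<omega>
    unfolding LTV by (intro continuous_intros contY that)
  have level: "l \<le> h * V0 / C * exp y \<longleftrightarrow> b \<le> y" for y
  proof -
    have "l \<le> h * V0 / C * exp y \<longleftrightarrow> l / (h * V0 / C) \<le> exp y"
      using pos_divide_le_eq[OF L0, of l "exp y"] by (simp only: mult.commute)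
    also have "\<dots> \<longleftrightarrow> b \<le> y"
    proof -
      have "0 < l / (h * V0 / C)"
        by (rule divide_pos_pos[OF less_le_trans[OF L0 l] L0])
      then have "exp b = l / (h * V0 / C)"
        unfolding b_def by (rule exp_ln)
      then show ?thesis
        using exp_le_cancel_iff[of b y] by simp
    qed
    finally show ?thesis .
  qed
  have "liquidation_time l (loan_to_value h V0 C (geometric_bm 2 0 \<sigma> Wt)) \<omega> \<le> ereal T
      \<longleftrightarrow> (\<exists>t\<in>{0..T}. b \<le> Y t \<omega>)" if "\<omega> \<in> space N" for \<omega>
    using liquidation_time_le_iff[where X = "loan_to_value h V0 C (geometric_bm 2 0 \<sigma> Wt)", OF contL[OF that]]
    by (simp only: LTV level)
  then have "{\<omega>\<in>space N. liquidation_time l (loan_to_value h V0 C (geometric_bm 2 0 \<sigma> Wt)) \<omega> \<le> ereal T}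
      = {\<omega>\<in>space N. \<exists>t\<in>{0..T}. b \<le> Y t \<omega>}"
    by (intro Collect_cong conj_cong refl)
  also have "measure N \<dots> = prob {\<omega>\<in>space N. \<exists>t\<in>{0..T}. b \<le> log_price t \<omega>}"
  proof (rule finite_measure_eq_AE)
    have "AE \<omega> in N. Wt 0 \<omega> = 0"
      using bm by (simp add: brownian_motion_def)
    then show "AE \<omega> in N. \<omega> \<in> {\<omega>\<in>space N. \<exists>t\<in>{0..T}. b \<le> Y t \<omega>}
        \<longleftrightarrow> \<omega> \<in> {\<omega>\<in>space N. \<exists>t\<in>{0..T}. b \<le> log_price t \<omega>}"
      by (rule eventually_mono) (simp add: log_price_def Y_def)
    show "{\<omega>\<in>space N. \<exists>t\<in>{0..T}. b \<le> Y t \<omega>} \<in> sets N"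
    proof (rule sets_continuous_crossing[OF _ contY T])
      fix t :: real assume "0 \<le> t"
      then have [measurable]: "Wt t \<in> borel_measurable N"
        by (rule borel_measurable_W)
      show "Y t \<in> borel_measurable N"
        unfolding Y_def by measurable
    qed
    show "{\<omega>\<in>space N. \<exists>t\<in>{0..T}. b \<le> log_price t \<omega>} \<in> sets N"
      using T by (rule sets_crossing)
  qed
  also have "\<dots> = crossing_prob (\<sigma> * sqrt T) b"
    by (rule prob_crossing[OF T b])
  finally show ?thesis
    by (simp add: b_def)
qed

text \<open>Both moments are values of the Gaussian moment generating function, at
  \<open>\<sigma>\<close> and at \<open>2 * \<sigma>\<close>.\<close>

lemma geometric_bm_moments:
  assumes "prob_space N" and bm: "brownian_motion N W" and t: "0 < t"
  shows "(\<integral>\<omega>. geometric_bm z \<mu> \<sigma> W t \<omega> \<partial>N) = z * exp (\<mu> * t)"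
    and "(\<integral>\<omega>. (geometric_bm z \<mu> \<sigma> W t \<omega>)\<^sup>2 \<partial>N) = z\<^sup>2 * exp (2 * \<mu> * t + \<sigma>\<^sup>2 * t)"
proof -
  interpret prob_space N by fact
  have [measurable]: "W t \<in> borel_measurable N" "W 0 \<in> borel_measurable N"
    using bm t by (simp_all add: brownian_motion_def)
  have "distributed N lborel (\<lambda>\<omega>. W v \<omega> - W u \<omega>) (normal_density 0 (sqrt (v - u)))"
    if "0 \<le> u" "u < v" for u v
    using bm that by (simp add: brownian_motion_def)
  from this[OF order_refl t]
  have D: "distributed N lborel (\<lambda>\<omega>. W t \<omega> - W 0 \<omega>) (normal_density 0 (sqrt t))"
    by simp
  have W0: "AE \<omega> in N. W 0 \<omega> = 0"
    using bm by (simp add: brownian_motion_def)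
  have exp_W: "expectation (\<lambda>\<omega>. exp (c * W t \<omega>)) = exp (c\<^sup>2 * t / 2)" for c
  proof -
    have "expectation (\<lambda>\<omega>. exp (c * W t \<omega>)) = expectation (\<lambda>\<omega>. exp (c * (W t \<omega> - W 0 \<omega>)))"
      using W0 by (intro integral_cong_AE) (auto elim: eventually_mono)
    also have "\<dots> = exp (c\<^sup>2 * t / 2)"
      using normal_distributed_exp(2)[OF _ D, of c] t by simp
    finally show ?thesis .
  qed
  have "(\<integral>\<omega>. geometric_bm z \<mu> \<sigma> W t \<omega> \<partial>N) = (\<integral>\<omega>. z * exp ((\<mu> - \<sigma>\<^sup>2 / 2) * t) * exp (\<sigma> * W t \<omega>) \<partial>N)"
    by (simp add: geometric_bm_def exp_add mult.assoc)
  also have "\<dots> = z * (exp ((\<mu> - \<sigma>\<^sup>2 / 2) * t) * exp (\<sigma>\<^sup>2 * t / 2))"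
    by (simp add: exp_W)
  also have "\<dots> = z * exp (\<mu> * t)"
    by (simp add: exp_add[symmetric] algebra_simps)
  finally show "(\<integral>\<omega>. geometric_bm z \<mu> \<sigma> W t \<omega> \<partial>N) = z * exp (\<mu> * t)" .
  have "(geometric_bm z \<mu> \<sigma> W t \<omega>)\<^sup>2
      = z\<^sup>2 * exp (2 * ((\<mu> - \<sigma>\<^sup>2 / 2) * t)) * exp ((2 * \<sigma>) * W t \<omega>)" for \<omega>
    by (simp add: geometric_bm_def power_mult_distrib exp_double[symmetric] exp_add[symmetric] mult.assoc)
  then have "(\<integral>\<omega>. (geometric_bm z \<mu> \<sigma> W t \<omega>)\<^sup>2 \<partial>N)
      = z\<^sup>2 * (exp (2 * ((\<mu> - \<sigma>\<^sup>2 / 2) * t)) * exp ((2 * \<sigma>)\<^sup>2 * t / 2))"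
    using exp_W[of "2 * \<sigma>"] by simp
  also have "\<dots> = z\<^sup>2 * exp (2 * \<mu> * t + \<sigma>\<^sup>2 * t)"
    by (simp add: exp_add[symmetric] algebra_simps)
  finally show "(\<integral>\<omega>. (geometric_bm z \<mu> \<sigma> W t \<omega>)\<^sup>2 \<partial>N) = z\<^sup>2 * exp (2 * \<mu> * t + \<sigma>\<^sup>2 * t)" .
qed

text \<open>By \<open>1 + x \<le> exp x\<close> it is enough that \<open>(\<sigma>A -
  \<sigma>B)\<^sup>2 + 2 * (1 + \<rho>) * \<sigma>A * \<sigma>B\<close> is positive, which rests on
  \<open>-1 < \<rho>\<close>. Since 4 is the square of the mean, strictness rules out a vanishing
  matched volatility.\<close>

lemma second_moment_gt_4:
  fixes \<sigma>A \<sigma>B \<rho> t :: real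
  assumes "0 < \<sigma>A" "0 < \<sigma>B" "-1 < \<rho>" "0 < t"
  shows "4 < exp (\<sigma>A\<^sup>2 * t) + exp (\<sigma>B\<^sup>2 * t) + 2 * exp (\<rho> * \<sigma>A * \<sigma>B * t)"
proof -
  have "0 < 2 * ((1 + \<rho>) * (\<sigma>A * \<sigma>B))"
    using assms by simp
  also have "\<dots> \<le> (\<sigma>A - \<sigma>B)\<^sup>2 + 2 * ((1 + \<rho>) * (\<sigma>A * \<sigma>B))"
    by simp
  also have "\<dots> = \<sigma>A\<^sup>2 + \<sigma>B\<^sup>2 + 2 * (\<rho> * \<sigma>A * \<sigma>B)"
    by (simp add: power2_diff algebra_simps)
  finally have "0 < (\<sigma>A\<^sup>2 + \<sigma>B\<^sup>2 + 2 * (\<rho> * \<sigma>A * \<sigma>B)) * t"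
    using assms(4) by simp
  then have "0 < \<sigma>A\<^sup>2 * t + \<sigma>B\<^sup>2 * t + 2 * (\<rho> * \<sigma>A * \<sigma>B * t)"
    by (simp add: algebra_simps)
  then show ?thesis
    using exp_ge_add_one_self[of "\<sigma>A\<^sup>2 * t"] exp_ge_add_one_self[of "\<sigma>B\<^sup>2 * t"]
      exp_ge_add_one_self[of "\<rho> * \<sigma>A * \<sigma>B * t"]
    by linarith
qed

text \<open>The formula is exact for the approximating process; the approximation lies in putting
  that process in place of the true price sum. Matching at one time \<open>t0\<close> fixes drift
  and volatility, which are then kept over \<open>{0..T}\<close>; \<open>t0 = T\<close> is the
  choice of the horizon itself.\<close>

theorem proposition6:
  fixes M :: "'a measure" and F :: "real \<Rightarrow> 'a measure"
    and WA WB SA SB :: "real \<Rightarrow> 'a \<Rightarrow> real"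
    and N :: "'b measure" and Wt :: "real \<Rightarrow> 'b \<Rightarrow> real"
    and \<sigma>A \<sigma>B \<rho> h V0 C LTV0 lmax \<mu> \<sigma> \<nu> b t0 T :: real
  assumes "prob_space M" and "filtration (space M) F" and "\<And>t. subalgebra M (F t)"
    and "\<sigma>A > 0" and "\<sigma>B > 0" and "-1 < \<rho>" and "\<rho> < 1"
    and "correlated_brownian_motions M F \<rho> WA WB"
    and "driftless_price_process M F WA \<sigma>A SA"
    and "driftless_price_process M F WB \<sigma>B SB"
    and "V0 > 0" and "C > 0" and "0 < h" and "h \<le> 1"
    and "LTV0 = h * V0 / C" and "lmax \<ge> LTV0"
    and "prob_space N" and "brownian_motion N Wt"
    and "\<sigma> \<ge> 0" and "t0 > 0"
    and "same_two_moments N (geometric_bm 2 \<mu> \<sigma> Wt t0) M (relative_price_sum SA SB t0)"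
    and "\<nu> = \<mu> - \<sigma>\<^sup>2 / 2" and "b = ln (lmax * C / (h * V0))"
    and "T > 0"
  shows
    "(\<forall>\<omega>\<in>space M. loan_to_value h V0 C (relative_price_sum SA SB) 0 \<omega> = LTV0) \<and>
     \<mu> = 0 \<and> \<sigma> > 0 \<and>
     \<sigma>\<^sup>2 = 1 / t0 * ln ((exp (\<sigma>A\<^sup>2 * t0) + exp (\<sigma>B\<^sup>2 * t0) + 2 * exp (\<rho> * \<sigma>A * \<sigma>B * t0)) / 4) \<and>
     \<nu> = - \<sigma>\<^sup>2 / 2 \<and> b = ln (lmax / LTV0) \<and>
     exp (2 * \<nu> * b / \<sigma>\<^sup>2) = exp (- b) \<and> exp (- b) = LTV0 / lmax \<and>
     measure N {\<omega>\<in>space N.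
         liquidation_time lmax (loan_to_value h V0 C (geometric_bm 2 \<mu> \<sigma> Wt)) \<omega> \<le> ereal T} =
       \<Phi> ((- b - \<sigma>\<^sup>2 / 2 * T) / (\<sigma> * sqrt T)) +
       LTV0 / lmax * \<Phi> ((- b + \<sigma>\<^sup>2 / 2 * T) / (\<sigma> * sqrt T))"
proof -
  let ?S = "exp (\<sigma>A\<^sup>2 * t0) + exp (\<sigma>B\<^sup>2 * t0) + 2 * exp (\<rho> * \<sigma>A * \<sigma>B * t0)"
  interpret filtered_prob_space M F
    using assms(1-3) by (simp add: filtered_prob_space_def filtered_prob_space_axioms_def)
  have Z: "expectation (relative_price_sum SA SB t0) = 2"
    "expectation (\<lambda>\<omega>. (relative_price_sum SA SB t0 \<omega>)\<^sup>2) = ?S"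
    using assms by (intro relative_price_sum_moments[OF assms(8-10)]; simp)+
  note G = geometric_bm_moments[OF assms(17,18,20), of 2 \<mu> \<sigma>]
  have "2 * exp (\<mu> * t0) = 2"
    using assms(21) G(1) Z(1) by (simp add: same_two_moments_def)
  then have \<mu>: "\<mu> = 0"
    using assms(20) by simp
  have "4 * exp (\<sigma>\<^sup>2 * t0) = ?S"
    using assms(21) G(2) Z(2) \<mu> by (simp add: same_two_moments_def)
  then have expS: "exp (\<sigma>\<^sup>2 * t0) = ?S / 4"
    by simp
  \<comment> \<open>The strict bound excludes \<open>\<sigma> = 0\<close>, so the later quotients by
    \<open>\<sigma>\<close> are genuine divisions.\<close>
  have "1 < exp (\<sigma>\<^sup>2 * t0)"
    unfolding expS using second_moment_gt_4[OF assms(4,5,6,20)] by simp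
  then have \<sigma>: "0 < \<sigma>"
    using assms(19) by (cases "\<sigma> = 0") simp_all
  have "\<sigma>\<^sup>2 * t0 = ln (?S / 4)"
    unfolding expS[symmetric] by (rule ln_exp[symmetric])
  then have \<sigma>2: "\<sigma>\<^sup>2 = 1 / t0 * ln (?S / 4)"
    using assms(20) by (simp add: field_simps)
  have \<nu>: "\<nu> = - \<sigma>\<^sup>2 / 2"
    using assms(22) \<mu> by simp
  have L0: "0 < LTV0"
    using assms(11-13,15) by simp
  then have l: "0 < lmax"
    using assms(16) by (rule less_le_trans)
  have b: "b = ln (lmax / LTV0)"
    using assms(15,23) by simp
  have exp_b: "exp (- b) = LTV0 / lmax"
    using L0 l by (simp add: b exp_minus)
  have exp_\<nu>: "exp (2 * \<nu> * b / \<sigma>\<^sup>2) = exp (- b)"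
    using \<sigma> by (simp add: \<nu>)
  obtain a where a: "0 < a" "\<And>\<omega>. \<omega> \<in> space M \<Longrightarrow> SA 0 \<omega> = a"
    using assms(9) unfolding driftless_price_process_def by blast
  obtain d where d: "0 < d" "\<And>\<omega>. \<omega> \<in> space M \<Longrightarrow> SB 0 \<omega> = d"
    using assms(10) unfolding driftless_price_process_def by blast
  have LTV: "\<forall>\<omega>\<in>space M. loan_to_value h V0 C (relative_price_sum SA SB) 0 \<omega> = LTV0"
    using a d assms(12,15) by (simp add: loan_to_value_def relative_price_sum_def)
  have "measure N {\<omega>\<in>space N.
      liquidation_time lmax (loan_to_value h V0 C (geometric_bm 2 \<mu> \<sigma> Wt)) \<omega> \<le> ereal T}
    = crossing_prob (\<sigma> * sqrt T) b"
    unfolding \<mu> b assms(15)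
    using L0 assms(15,16) by (intro liquidation_probability assms(17,18,24) \<sigma>) simp_all
  also have "\<dots> = \<Phi> ((- b - \<sigma>\<^sup>2 / 2 * T) / (\<sigma> * sqrt T))
      + LTV0 / lmax * \<Phi> ((- b + \<sigma>\<^sup>2 / 2 * T) / (\<sigma> * sqrt T))"
    using assms(24) by (simp add: crossing_prob_def exp_b power_mult_distrib)
  finally show ?thesis
    using LTV \<mu> \<sigma> \<sigma>2 \<nu> b exp_\<nu> exp_b by blast
qed

end
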